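(* Let $\varepsilon\ge0$, $\delta\in[0,1]$, $n\ge1$, let $\mathcal{P}$ be a family of probability distributions on $\mathcal{X}$, let $\theta:\mathcal{P}\to\vartheta$ be a map into a parameter space $\vartheta$, and let $\ell:\vartheta\times\vartheta\to[0,\infty)$ be a semi-metric. If $P_0,P_1\in\mathcal{P}$ satisfy $\ell(\theta(P_0),\theta(P_1))\ge2\tau$ for some $\tau>0$, then $$\mathcal{R}_n(\mathcal{P},\ell,\varepsilon,\delta)\ge\frac{\tau}{2}\left[1-\sqrt{\frac{\varphi(\varepsilon,\delta)\,n}{2}D_{\mathsf{KL}}(P_0\|P_1)}\right],$$ where $\varphi(\varepsilon,\delta)=1-(1-\delta)e^{-\varepsilon}$ and $\mathcal{R}_n(\mathcal{P},\ell,\varepsilon,\delta)$ is the $(\varepsilon,\delta)$-LDP minimax risk over sequentially interactive mechanisms.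
   Context: A Markov kernel $\mathsf{K}:\mathcal{D}\to\mathcal{P}(\mathcal{W})$ (from $\mathcal{D}$ to probability measures on $\mathcal{W}$) is $(\varepsilon,\delta)$-LDP if $\sup_{x_1,x_2\in\mathcal{D}}\sup_{A\subset\mathcal{W}}[\mathsf{K}(A|x_1)-e^\varepsilon\mathsf{K}(A|x_2)]\le\delta$ ($A$ measurable); $\mathcal{Q}_{\varepsilon,\delta}$ is the family of all such kernels. Sequentially interactive setting: $X_1,\dots,X_n$ are i.i.d. from $P\in\mathcal{P}$; for each $i$, the output $Z_i\in\mathcal{Z}_i$ is generated, conditionally on $(X_i,Z_1,\dots,Z_{i-1})$, by a Markov kernel $\mathsf{K}_i$ with domain $\mathcal{X}\times\mathcal{Z}_1\times\cdots\times\mathcal{Z}_{i-1}$ and values in the probability measures on $\mathcal{Z}_i$ (and $Z_i$ is conditionally independent of the other $X_j$). The private minimax risk is $$\mathcal{R}_n(\mathcal{P},\ell,\varepsilon,\delta)=\inf_{\mathsf{K}_1,\dots,\mathsf{K}_n\in\mathcal{Q}_{\varepsilon,\delta}}\ \inf_{\Psi}\ \sup_{P\in\mathcal{P}}\mathbb{E}[\ell(\Psi(Z_1,\dots,Z_n),\theta(P))],$$ where $\Psi:\mathcal{Z}_1\times\cdots\times\mathcal{Z}_n\to\vartheta$ ranges over (measurable) estimators. Semi-metric means: $\ell(a,a)=0$, $\ell$ is symmetric and satisfies the triangle inequality (but $\ell(a,b)=0$ need not imply $a=b$). $D_{\mathsf{KL}}$ is the Kullback-Leibler divergence (natural logarithm).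 *)

theory Defs
  imports "HOL-Probability.Probability"
begin

definition semimetric_on :: "'t set \<Rightarrow> ('t \<Rightarrow> 't \<Rightarrow> real) \<Rightarrow> bool" where
  "semimetric_on S l \<longleftrightarrow>
     (\<forall>a\<in>S. \<forall>b\<in>S. 0 \<le> l a b) \<and>
     (\<forall>a\<in>S. l a a = 0) \<and>
     (\<forall>a\<in>S. \<forall>b\<in>S. l a b = l b a) \<and>
     (\<forall>a\<in>S. \<forall>b\<in>S. \<forall>c\<in>S. l a c \<le> l a b + l b c)"

(* D(P || Q) as an extended real, in nats. The library's KL_divergence takes the reference
   measure Q first and is a Bochner integral, hence a junk real number where the divergence is
   infinite. For probability measures with P << Q the negative part of the log-density is always
   P-integrable, so failure of integrability means divergence to +infinity. *)
definition KL_div :: "'a measure \<Rightarrow> 'a measure \<Rightarrow> ereal" where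
  "KL_div P Q =
     (if absolutely_continuous Q P \<and> integrable P (entropy_density (exp 1) Q P)
      then ereal (KL_divergence (exp 1) Q P) else \<infinity>)"

(* The square root on [0, \<infinity>]. *)
definition esqrt :: "ereal \<Rightarrow> ereal" where
  "esqrt x = (if x = \<infinity> then \<infinity> else ereal (sqrt (real_of_ereal x)))"

definition ldp_kernels :: "real \<Rightarrow> real \<Rightarrow> 'd measure \<Rightarrow> 'w measure \<Rightarrow> ('d \<Rightarrow> 'w measure) set" where
  "ldp_kernels \<epsilon> \<delta> D W =
     {K \<in> D \<rightarrow>\<^sub>M prob_algebra W.
        \<forall>x1\<in>space D. \<forall>x2\<in>space D. \<forall>A\<in>sets W.
          measure (K x1) A - exp \<epsilon> * measure (K x2) A \<le> \<delta>}"

(* The kernels are numbered 0, ..., n-1; kernel i reads the i-th sample and the earlier outputs,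
   the latter being a point of the product of Z 0, ..., Z (i-1). The privacy constraint protects
   the sample: it is imposed on the kernel x \<mapsto> K i (x, z) for every fixed history z. Demanding
   it also across different histories would give a smaller class of mechanisms, hence a
   larger minimax risk. *)
definition interactive_mechanisms ::
  "real \<Rightarrow> real \<Rightarrow> nat \<Rightarrow> 'x measure \<Rightarrow> (nat \<Rightarrow> 'z measure) \<Rightarrow>
   (nat \<Rightarrow> 'x \<times> (nat \<Rightarrow> 'z) \<Rightarrow> 'z measure) set" where
  "interactive_mechanisms \<epsilon> \<delta> n X Z =
     {K. \<forall>i<n. K i \<in> (X \<Otimes>\<^sub>M PiM {..<i} Z) \<rightarrow>\<^sub>M prob_algebra (Z i) \<and>
        (\<forall>z\<in>space (PiM {..<i} Z). (\<lambda>x. K i (x, z)) \<in> ldp_kernels \<epsilon> \<delta> X (Z i))}"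

(* Conditional law of the first i outputs given the samples x. *)
primrec transcript_law ::
  "(nat \<Rightarrow> 'z measure) \<Rightarrow> (nat \<Rightarrow> 'x \<times> (nat \<Rightarrow> 'z) \<Rightarrow> 'z measure) \<Rightarrow> (nat \<Rightarrow> 'x) \<Rightarrow> nat \<Rightarrow>
   (nat \<Rightarrow> 'z) measure" where
  "transcript_law Z K x 0 = return (PiM {} Z) (\<lambda>_. undefined)"
| "transcript_law Z K x (Suc i) =
     transcript_law Z K x i \<bind>
       (\<lambda>z. distr (K i (x i, z)) (PiM {..<Suc i} Z) (\<lambda>w. z(i := w)))"

(* Law of all n outputs when the n samples are i.i.d. from P. *)
definition output_law ::
  "nat \<Rightarrow> (nat \<Rightarrow> 'z measure) \<Rightarrow> (nat \<Rightarrow> 'x \<times> (nat \<Rightarrow> 'z) \<Rightarrow> 'z measure) \<Rightarrow> 'x measure \<Rightarrow>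
   (nat \<Rightarrow> 'z) measure" where
  "output_law n Z K P = PiM {..<n} (\<lambda>_. P) \<bind> (\<lambda>x. transcript_law Z K x n)"

(* The output spaces Z i are measurable spaces of the mechanism's choice, carried by arbitrary
   subsets of one ambient type 'z; n spaces on n different types embed into the sum type. *)
definition minimax_risk ::
  "'z itself \<Rightarrow> nat \<Rightarrow> 'x measure \<Rightarrow> 't measure \<Rightarrow> 'x measure set \<Rightarrow> ('x measure \<Rightarrow> 't) \<Rightarrow>
   ('t \<Rightarrow> 't \<Rightarrow> real) \<Rightarrow> real \<Rightarrow> real \<Rightarrow> ennreal" where
  "minimax_risk _ n X T \<P> \<theta> l \<epsilon> \<delta> =
     (INF Z :: nat \<Rightarrow> 'z measure.
      INF K \<in> interactive_mechanisms \<epsilon> \<delta> n X Z.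
      INF \<Psi> \<in> PiM {..<n} Z \<rightarrow>\<^sub>M T.
      SUP P \<in> \<P>. \<integral>\<^sup>+ z. ennreal (l (\<Psi> z) (\<theta> P)) \<partial>output_law n Z K P)"

end

theory Submission imports Defs begin

text \<open>
  The relative entropy is used only through its Donsker--Varadhan dual form: a bound \<open>c\<close> on the
  divergence of \<open>P\<close> from \<open>Q\<close> means \<open>E_P h \<le> ln (E_Q exp h) + c\<close> for all bounded \<open>h\<close>. In this form the
  chain rule is a nested application of the inequality and Pinsker's inequality is Hoeffding's
  lemma for \<open>h = r * indicator A\<close>.

  An \<open>(\<epsilon>, \<delta>)\<close>-private kernel has outputs at mutual total variation distance at most
  \<open>\<phi> = 1 - (1 - \<delta>) exp (- \<epsilon>)\<close>, and such a kernel \<open>K\<close> contracts the divergence by \<open>\<phi>\<close>. By duality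
  the latter reduces to the following: if \<open>F x = \<integral> h \<partial>K x\<close> and \<open>G x = \<integral> exp h \<partial>K x\<close> satisfy
  \<open>E_Q G = 1\<close>, then \<open>E_Q exp (F / \<phi>) \<le> 1\<close>. When \<open>Q\<close> has two atoms, the two output laws share a
  component of mass \<open>1 - \<phi>\<close>, and Jensen's inequality on the remainders gives the claim. For general
  \<open>Q\<close>, the two-point case provides a line through \<open>(1, 1)\<close> above all points
  \<open>(G x, exp (F x / \<phi>))\<close>, which is then integrated.

  Since the samples are independent, the output law is an iterated composition of the kernels
  averaged over one sample each, so \<open>n\<close> steps cost \<open>n * \<phi>\<close> times the divergence, and Le Cam's
  two-point argument finishes the proof.
\<close>

subsection \<open>The two-point inequality\<close>

lemma integrable_mult_bounded:
  fixes g h :: "'a \<Rightarrow> real"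
  assumes "integrable S g" and "h \<in> borel_measurable S" and "\<And>x. x \<in> space S \<Longrightarrow> \<bar>h x\<bar> \<le> B"
  shows "integrable S (\<lambda>x. g x * h x)"
proof (rule Bochner_Integration.integrable_bound)
  show "integrable S (\<lambda>x. B * g x)" using assms(1) by simp
  show "(\<lambda>x. g x * h x) \<in> borel_measurable S"
    using assms(1,2) by measurable
  show "AE x in S. norm (g x * h x) \<le> norm (B * g x)"
  proof (rule AE_I2)
    fix x assume "x \<in> space S"
    from assms(3)[OF this] have "\<bar>h x\<bar> * \<bar>g x\<bar> \<le> \<bar>B\<bar> * \<bar>g x\<bar>"
      by (intro mult_right_mono) auto
    then show "norm (g x * h x) \<le> norm (B * g x)" by (simp add: abs_mult mult.commute)
  qed
qed

lemma integrable_mult_exp_bounded: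
  fixes g h :: "'a \<Rightarrow> real"
  assumes "integrable S g" and [measurable]: "h \<in> borel_measurable S"
    and "\<And>x. x \<in> space S \<Longrightarrow> \<bar>h x\<bar> \<le> B"
  shows "integrable S (\<lambda>x. g x * exp (h x))"
  using assms(1) by (rule integrable_mult_bounded[where B = "exp B"]) (use assms(3) in \<open>force+\<close>)

text \<open>Jensen's inequality for a weight of arbitrary mass \<open>w\<close>: the tangent of
  \<open>exp\<close> at the weighted mean \<open>c\<close> lies below \<open>exp\<close>, and
  integrating it against \<open>g\<close> gives exactly \<open>w * exp c\<close>.\<close>

lemma weighted_jensen_exp:
  fixes g h :: "'a \<Rightarrow> real"
  assumes g: "integrable S g" "\<And>x. x \<in> space S \<Longrightarrow> 0 \<le> g x"
    and h: "h \<in> borel_measurable S" "\<And>x. x \<in> space S \<Longrightarrow> \<bar>h x\<bar> \<le> B"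
    and w: "(\<integral>x. g x \<partial>S) = w" "0 < w"
  shows "w * exp ((\<integral>x. g x * h x \<partial>S) / w) \<le> (\<integral>x. g x * exp (h x) \<partial>S)"
proof -
  define c where "c = (\<integral>x. g x * h x \<partial>S) / w"
  note int = integrable_mult_bounded[OF g(1) h] integrable_mult_exp_bounded[OF g(1) h]
  have "w * exp c = exp c * ((1 - c) * w + c * w)" by (simp add: algebra_simps)
  also have "c * w = (\<integral>x. g x * h x \<partial>S)" using w by (simp add: c_def)
  also have "exp c * ((1 - c) * w + \<dots>) = (\<integral>x. exp c * ((1 - c) * g x + g x * h x) \<partial>S)"
    using g(1) int w by simp
  also have "\<dots> \<le> (\<integral>x. g x * exp (h x) \<partial>S)"
  proof (rule integral_mono)
    fix x assume x: "x \<in> space S"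
    have "exp c * (1 + (h x - c)) \<le> exp c * exp (h x - c)"
      by (intro mult_left_mono exp_ge_add_one_self) auto
    then have "g x * (exp c * (1 + (h x - c))) \<le> g x * exp (h x)"
      using g(2)[OF x] by (intro mult_left_mono) (auto simp flip: exp_add)
    then show "exp c * ((1 - c) * g x + g x * h x) \<le> g x * exp (h x)"
      by (simp add: algebra_simps)
  qed (use g(1) int in auto)
  finally show ?thesis by (simp add: c_def)
qed

text \<open>This is the contraction in dual form for an input law with two atoms of weights
  \<open>t\<close> and \<open>1 - t\<close>. A common part \<open>q\<close> of mass
  \<open>1 - \<phi>\<close> is split off both densities. It contributes the same factor
  \<open>exp (N / \<phi>)\<close> to both terms, and what remains of each density has mass
  \<open>\<phi>\<close>, so that dividing by \<open>\<phi>\<close> turns it into a probability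
  density to which Jensen's inequality applies.\<close>

lemma two_point_exp_density:
  fixes k1 k2 h :: "'a \<Rightarrow> real"
  assumes k: "integrable S k1" "integrable S k2"
    and nn: "\<And>x. x \<in> space S \<Longrightarrow> 0 \<le> k1 x" "\<And>x. x \<in> space S \<Longrightarrow> 0 \<le> k2 x"
    and one: "(\<integral>x. k1 x \<partial>S) = 1" "(\<integral>x. k2 x \<partial>S) = 1"
    and tv: "(\<integral>x. k1 x - min (k1 x) (k2 x) \<partial>S) \<le> \<phi>" and \<phi>: "0 < \<phi>" "\<phi> \<le> 1"
    and h: "h \<in> borel_measurable S" "\<And>x. x \<in> space S \<Longrightarrow> \<bar>h x\<bar> \<le> B"
    and t: "0 \<le> t" "t \<le> 1"
    and norm: "t * (\<integral>x. k1 x * exp (h x) \<partial>S) + (1 - t) * (\<integral>x. k2 x * exp (h x) \<partial>S) = 1"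
  shows "t * exp ((\<integral>x. k1 x * h x \<partial>S) / \<phi>) + (1 - t) * exp ((\<integral>x. k2 x * h x \<partial>S) / \<phi>) \<le> 1"
proof -
  \<comment> \<open>\<open>q\<close> is the common component, rescaled to mass exactly \<open>1 - \<phi>\<close>. If \<open>m = 0\<close>, then \<open>\<phi> = 1\<close> and
    \<open>s = 0\<close> because of \<open>x / 0 = 0\<close>.\<close>
  define m where "m = (\<integral>x. min (k1 x) (k2 x) \<partial>S)"
  define s where "s = (1 - \<phi>) / m"
  define q where "q x = s * min (k1 x) (k2 x)" for x
  have imin: "integrable S (\<lambda>x. min (k1 x) (k2 x))" using k by simp
  have "1 - m \<le> \<phi>" using tv k imin one by (simp add: m_def)
  then have m: "1 - \<phi> \<le> m" by simp
  have s01: "0 \<le> s" "s \<le> 1" using m \<phi> by (auto simp: s_def divide_simps)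
  have q_int: "integrable S q" unfolding q_def using imin by simp
  have q_mass: "(\<integral>x. q x \<partial>S) = 1 - \<phi>"
  proof -
    have "(\<integral>x. q x \<partial>S) = s * m" unfolding q_def m_def by simp
    also have "\<dots> = 1 - \<phi>" using m \<phi> by (cases "m = 0") (auto simp: s_def)
    finally show ?thesis .
  qed
  have q0: "0 \<le> q x" and q1: "q x \<le> k1 x" and q2: "q x \<le> k2 x" if "x \<in> space S" for x
  proof -
    have mm: "0 \<le> min (k1 x) (k2 x)" using nn[OF that] by simp
    then show "0 \<le> q x" using s01 by (simp add: q_def)
    have "q x \<le> 1 * min (k1 x) (k2 x)" unfolding q_def by (intro mult_right_mono s01 mm)
    then show "q x \<le> k1 x" "q x \<le> k2 x" by auto
  qed
  define N where "N = (\<integral>x. q x * h x \<partial>S)"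
  define M where "M = (\<integral>x. q x * exp (h x) \<partial>S)"
  define G where "G k = (\<integral>x. (k x - q x) * exp (h x) \<partial>S)" for k
  \<comment> \<open>The inequality \<open>1 + h \<le> exp h\<close>, integrated against
    \<open>q\<close>.\<close>
  have M_ge: "1 - \<phi> + N \<le> M"
  proof -
    have "1 - \<phi> + N = (\<integral>x. q x + q x * h x \<partial>S)"
      using q_int integrable_mult_bounded[OF q_int h] q_mass by (simp add: N_def)
    also have "\<dots> \<le> M" unfolding M_def
    proof (rule integral_mono)
      fix x assume "x \<in> space S"
      from mult_left_mono[OF exp_ge_add_one_self q0[OF this], of "h x"]
      show "q x + q x * h x \<le> q x * exp (h x)" by (simp add: algebra_simps)
    qed (use q_int integrable_mult_bounded[OF q_int h] integrable_mult_exp_bounded[OF q_int h] in auto)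
    finally show ?thesis .
  qed
  \<comment> \<open>The exponential factors along \<open>k = q + (k - q)\<close>; Jensen's
    inequality bounds the factor of the remainder by \<open>G k / \<phi>\<close>.\<close>
  have each: "exp ((\<integral>x. k x * h x \<partial>S) / \<phi>) \<le> exp (N / \<phi>) * (G k / \<phi>)"
    and each': "(\<integral>x. k x * exp (h x) \<partial>S) = M + G k"
    if k: "integrable S k" "\<And>x. x \<in> space S \<Longrightarrow> q x \<le> k x" "(\<integral>x. k x \<partial>S) = 1" for k
  proof -
    let ?g = "\<lambda>x. k x - q x"
    have g: "integrable S ?g" using k q_int by simp
    have mass: "(\<integral>x. ?g x \<partial>S) = \<phi>" using k q_int q_mass by simp
    have "\<phi> * exp ((\<integral>x. ?g x * h x \<partial>S) / \<phi>) \<le> G k"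
      unfolding G_def using k(2) by (intro weighted_jensen_exp[OF g _ h mass]) (auto simp: \<phi>)
    moreover have "(\<integral>x. k x * h x \<partial>S) = N + (\<integral>x. ?g x * h x \<partial>S)"
      unfolding N_def left_diff_distrib
      using integrable_mult_bounded[OF q_int h] integrable_mult_bounded[OF k(1) h] by simp
    ultimately show "exp ((\<integral>x. k x * h x \<partial>S) / \<phi>) \<le> exp (N / \<phi>) * (G k / \<phi>)"
      using \<phi> by (simp add: add_divide_distrib exp_add pos_le_divide_eq mult.commute)
    show "(\<integral>x. k x * exp (h x) \<partial>S) = M + G k"
      unfolding M_def G_def left_diff_distrib
      using integrable_mult_exp_bounded[OF q_int h] integrable_mult_exp_bounded[OF k(1) h] by simp
  qed
  note e1 = each[OF k(1) q1 one(1)] and e2 = each[OF k(2) q2 one(2)]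
  have "t * exp ((\<integral>x. k1 x * h x \<partial>S) / \<phi>) + (1 - t) * exp ((\<integral>x. k2 x * h x \<partial>S) / \<phi>)
      \<le> t * (exp (N / \<phi>) * (G k1 / \<phi>)) + (1 - t) * (exp (N / \<phi>) * (G k2 / \<phi>))"
    using t by (intro add_mono mult_left_mono e1 e2) auto
  also have "\<dots> = exp (N / \<phi>) * ((t * G k1 + (1 - t) * G k2) / \<phi>)"
    by (simp add: algebra_simps add_divide_distrib diff_divide_distrib)
  \<comment> \<open>The normalization says that \<open>M\<close> plus the average of the
    \<open>G\<close> terms is 1, so \<open>M_ge\<close> leaves at most \<open>\<phi> - N\<close> for
    that average. After division by \<open>\<phi>\<close> this is the tangent of \<open>exp\<close>
    at 0, evaluated at \<open>- N / \<phi>\<close>.\<close>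
  also have "\<dots> \<le> exp (N / \<phi>) * exp (- N / \<phi>)"
  proof (intro mult_left_mono)
    have "M + (t * G k1 + (1 - t) * G k2) = 1"
      using norm each'[OF k(1) q1 one(1)] each'[OF k(2) q2 one(2)]
      by (simp add: algebra_simps)
    with M_ge have "t * G k1 + (1 - t) * G k2 \<le> \<phi> - N" by simp
    then have "(t * G k1 + (1 - t) * G k2) / \<phi> \<le> (\<phi> - N) / \<phi>"
      using \<phi> by (intro divide_right_mono) auto
    also have "\<dots> = 1 + (- N / \<phi>)" using \<phi> by (simp add: diff_divide_distrib)
    also have "\<dots> \<le> exp (- N / \<phi>)" by (rule exp_ge_add_one_self)
    finally show "(t * G k1 + (1 - t) * G k2) / \<phi> \<le> exp (- N / \<phi>)" .
  qed auto
  also have "\<dots> = 1" by (simp flip: exp_add)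
  finally show ?thesis .
qed

section \<open>Reduction of arbitrary output laws to densities\<close>

lemma obtain_real_density:
  assumes "prob_space S" "prob_space N" "absolutely_continuous S N" "sets N = sets S"
  obtains D :: "'a \<Rightarrow> real" where "D \<in> borel_measurable S" "\<And>x. 0 \<le> D x"
    "AE x in S. RN_deriv S N x = ennreal (D x)" "N = density S (\<lambda>x. ennreal (D x))"
proof -
  interpret S: prob_space S by fact
  interpret N: prob_space N by fact
  obtain D where D: "D \<in> borel_measurable S" "AE x in S. RN_deriv S N x = ennreal (D x)"
      "\<And>x. 0 \<le> D x"
    using S.real_RN_deriv[OF _ assms(3,4)] N.finite_measure_axioms by blast
  have "N = density S (RN_deriv S N)"
    using S.density_RN_deriv[OF assms(3,4)] by simp
  also have "\<dots> = density S (\<lambda>x. ennreal (D x))"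
    by (intro density_cong) (use D in auto)
  finally show ?thesis using D that by blast
qed

lemma probability_density_integral:
  fixes D :: "'a \<Rightarrow> real"
  assumes "prob_space (density S (\<lambda>x. ennreal (D x)))" "D \<in> borel_measurable S" "\<And>x. 0 \<le> D x"
  shows "integrable S D" "(\<integral>x. D x \<partial>S) = 1"
proof -
  interpret prob_space "density S (\<lambda>x. ennreal (D x))" by fact
  have "integrable (density S (\<lambda>x. ennreal (D x))) (\<lambda>_. 1::real)" by simp
  then show "integrable S D" using assms(2,3) by (subst (asm) integrable_density) auto
  have "(\<integral>x. 1 \<partial>density S (\<lambda>x. ennreal (D x))) = (1::real)" using prob_space by simp
  then show "(\<integral>x. D x \<partial>S) = 1" using assms(2,3) by (subst (asm) integral_density) auto
qed

text \<open>The fair mixture of the two laws serves: a null set of the mixture is null for both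
  components. Writing it as a \<open>bind\<close> over a coin makes it a probability measure at
  once.\<close>

lemma obtain_common_dominating:
  assumes M1: "M1 \<in> space (prob_algebra W)" and M2: "M2 \<in> space (prob_algebra W)"
  obtains S where "S \<in> space (prob_algebra W)" "absolutely_continuous S M1" "absolutely_continuous S M2"
proof -
  let ?B = "measure_pmf (bernoulli_pmf (1/2))" and ?K = "\<lambda>b. if b then M1 else M2"
  let ?S = "?B \<bind> ?K"
  have B: "?B \<in> space (prob_algebra (count_space UNIV))"
    by (simp add: space_prob_algebra prob_space_measure_pmf)
  have K: "?K \<in> count_space UNIV \<rightarrow>\<^sub>M prob_algebra W" using M1 M2 by simp
  have S: "?S \<in> space (prob_algebra W)"
    using prob_space_bind'[OF B K] sets_bind'[OF B K] by (simp add: space_prob_algebra)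
  have em: "emeasure ?S A = ennreal (1/2) * emeasure M1 A + ennreal (1/2) * emeasure M2 A"
    if "A \<in> sets W" for A
    by (subst emeasure_bind_prob_algebra[OF B K that]) (simp add: nn_integral_bernoulli_pmf mult.commute)
  have "absolutely_continuous ?S M" if "M = M1 \<or> M = M2" for M
    unfolding absolutely_continuous_def
  proof
    fix A assume "A \<in> null_sets ?S"
    then have A: "A \<in> sets W" "emeasure ?S A = 0"
      using S by (auto simp: null_sets_def space_prob_algebra)
    with em have "emeasure M1 A = 0" "emeasure M2 A = 0" by auto
    then show "A \<in> null_sets M"
      using that A M1 M2 by (auto simp: null_sets_def space_prob_algebra)
  qed
  then show ?thesis using that S by blast
qed

lemma two_point_exp:
  fixes h :: "'a \<Rightarrow> real"
  assumes M1: "M1 \<in> space (prob_algebra W)" and M2: "M2 \<in> space (prob_algebra W)"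
    and tv: "\<And>A. A \<in> sets W \<Longrightarrow> measure M1 A - measure M2 A \<le> \<phi>" and \<phi>: "0 < \<phi>" "\<phi> \<le> 1"
    and h: "h \<in> borel_measurable W" "\<And>x. x \<in> space W \<Longrightarrow> \<bar>h x\<bar> \<le> B"
    and t: "0 \<le> t" "t \<le> 1"
    and norm: "t * (\<integral>x. exp (h x) \<partial>M1) + (1 - t) * (\<integral>x. exp (h x) \<partial>M2) = 1"
  shows "t * exp ((\<integral>x. h x \<partial>M1) / \<phi>) + (1 - t) * exp ((\<integral>x. h x \<partial>M2) / \<phi>) \<le> 1"
proof -
  obtain S where S: "S \<in> space (prob_algebra W)" "absolutely_continuous S M1" "absolutely_continuous S M2"
    using obtain_common_dominating[OF M1 M2] .
  have ps: "prob_space S" "prob_space M1" "prob_space M2"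
    and st: "sets M1 = sets S" "sets M2 = sets S" "sets S = sets W"
    using S M1 M2 by (auto simp: space_prob_algebra)
  note [measurable_cong] = st(3)
  have sp: "space S = space W" using st(3) by (rule sets_eq_imp_space_eq)
  obtain k1 where k1: "k1 \<in> borel_measurable S" "\<And>x. 0 \<le> k1 x" "M1 = density S (\<lambda>x. ennreal (k1 x))"
    using obtain_real_density[OF ps(1,2) S(2) st(1)] by blast
  obtain k2 where k2: "k2 \<in> borel_measurable S" "\<And>x. 0 \<le> k2 x" "M2 = density S (\<lambda>x. ennreal (k2 x))"
    using obtain_real_density[OF ps(1,3) S(3) st(2)] by blast
  note p1 = probability_density_integral[OF ps(2)[unfolded k1(3)] k1(1,2)]
  note p2 = probability_density_integral[OF ps(3)[unfolded k2(3)] k2(1,2)]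
  have hS[measurable]: "h \<in> borel_measurable S" using h by measurable
  have I1: "(\<integral>x. f x \<partial>M1) = (\<integral>x. k1 x * f x \<partial>S)"
    and I2: "(\<integral>x. f x \<partial>M2) = (\<integral>x. k2 x * f x \<partial>S)"
    if "f \<in> borel_measurable S" for f :: "'a \<Rightarrow> real"
    unfolding k1(3) k2(3) using that k1 k2 by (subst integral_density; simp)+
  \<comment> \<open>On this Hahn set the excess of \<open>k1\<close> over \<open>min k1 k2\<close>
    equals \<open>k1 - k2\<close>, and off it the excess vanishes. One event thus converts the
    setwise bound \<open>tv\<close> into the integral bound on densities.\<close>
  let ?A = "{x\<in>space S. k2 x < k1 x}"
  have A: "?A \<in> sets S" using k1(1) k2(1) by measurable
  interpret M1: prob_space M1 by fact
  interpret M2: prob_space M2 by fact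
  have m1: "measure M1 ?A = (\<integral>x. k1 x * indicator ?A x \<partial>S)"
    using I1[of "indicator ?A"] A st by simp
  have m2: "measure M2 ?A = (\<integral>x. k2 x * indicator ?A x \<partial>S)"
    using I2[of "indicator ?A"] A st by simp
  have "(\<integral>x. k1 x - min (k1 x) (k2 x) \<partial>S)
      = (\<integral>x. k1 x * indicator ?A x - k2 x * indicator ?A x \<partial>S)"
    by (intro Bochner_Integration.integral_cong) (auto simp: indicator_def)
  also have "\<dots> = measure M1 ?A - measure M2 ?A"
    unfolding m1 m2 using p1 p2 A by (intro Bochner_Integration.integral_diff integrable_real_mult_indicator) auto
  also have "\<dots> \<le> \<phi>" using tv A st by simp
  finally have "(\<integral>x. k1 x - min (k1 x) (k2 x) \<partial>S) \<le> \<phi>" .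
  from two_point_exp_density[where B = B, OF p1(1) p2(1) k1(2) k2(2) p1(2) p2(2) this \<phi> hS _ t]
  show ?thesis using norm h(2) by (simp add: I1 I2 sp)
qed

subsection \<open>Relative entropy bounds in dual form\<close>

text \<open>Restricting to bounded \<open>h\<close> keeps every integral finite and the argument of
  \<open>ln\<close> positive, so real-valued integrals suffice and no densities have to be carried
  through compositions of kernels.\<close>

definition dv_bounded :: "'a measure \<Rightarrow> 'a measure \<Rightarrow> 'a measure \<Rightarrow> real \<Rightarrow> bool" where
  "dv_bounded W P Q c \<longleftrightarrow>
     (\<forall>h\<in>borel_measurable W. \<forall>B. (\<forall>x\<in>space W. \<bar>h x\<bar> \<le> B) \<longrightarrow>
        (\<integral>x. h x \<partial>P) \<le> ln (\<integral>x. exp (h x) \<partial>Q) + c)"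

lemma dv_boundedD:
  assumes "dv_bounded W P Q c" "h \<in> borel_measurable W" "\<And>x. x \<in> space W \<Longrightarrow> \<bar>h x\<bar> \<le> B"
  shows "(\<integral>x. h x \<partial>P) \<le> ln (\<integral>x. exp (h x) \<partial>Q) + c"
  using assms unfolding dv_bounded_def by blast

lemma space_prob_algebraD: "P \<in> space (prob_algebra W) \<Longrightarrow> space P = space W"
  using sets_eq_imp_space_eq[of P W] by (simp add: space_prob_algebra)

lemma prob_algebra_integrable_bounded:
  fixes h :: "'a \<Rightarrow> real"
  assumes "P \<in> space (prob_algebra W)" and "h \<in> borel_measurable W"
    and "\<And>x. x \<in> space W \<Longrightarrow> \<bar>h x\<bar> \<le> B"
  shows "integrable P h"
proof -
  interpret prob_space P using assms(1) by (simp add: space_prob_algebra)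
  have [measurable_cong]: "sets P = sets W" using assms(1) by (simp add: space_prob_algebra)
  have "space P = space W" by (rule sets_eq_imp_space_eq) fact
  then show ?thesis
    using assms(2,3) by (intro integrable_const_bound[of h B]) auto
qed

lemma prob_algebra_integral_bounds:
  fixes h :: "'a \<Rightarrow> real"
  assumes P: "P \<in> space (prob_algebra W)" and h: "h \<in> borel_measurable W"
    and lo: "\<And>x. x \<in> space W \<Longrightarrow> l \<le> h x" and hi: "\<And>x. x \<in> space W \<Longrightarrow> h x \<le> u"
  shows "l \<le> (\<integral>x. h x \<partial>P)" "(\<integral>x. h x \<partial>P) \<le> u"
proof -
  interpret prob_space P using P by (simp add: space_prob_algebra)
  have sp: "space P = space W" using P by (rule space_prob_algebraD)
  have i: "integrable P h"
    using P h
  proof (rule prob_algebra_integrable_bounded)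
    fix x assume "x \<in> space W"
    from lo[OF this] hi[OF this] show "\<bar>h x\<bar> \<le> \<bar>l\<bar> + \<bar>u\<bar>" by simp
  qed
  show "l \<le> (\<integral>x. h x \<partial>P)" using i lo sp by (intro integral_ge_const) auto
  show "(\<integral>x. h x \<partial>P) \<le> u" using i hi sp by (intro integral_le_const) auto
qed

text \<open>The bound on the logarithm makes
  \<open>ln (\<integral>x. exp (h x) \<partial>L y)\<close>, as a function of \<open>y\<close>, an
  admissible bounded test function again; the chain rule depends on this.\<close>

lemma prob_algebra_exp_integral_bounds:
  fixes h :: "'a \<Rightarrow> real"
  assumes P: "P \<in> space (prob_algebra W)" and [measurable]: "h \<in> borel_measurable W"
    and B: "\<And>x. x \<in> space W \<Longrightarrow> \<bar>h x\<bar> \<le> B"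
  shows "integrable P (\<lambda>x. exp (h x))" "0 < (\<integral>x. exp (h x) \<partial>P)" "\<bar>ln (\<integral>x. exp (h x) \<partial>P)\<bar> \<le> B"
    "\<bar>\<integral>x. exp (h x) \<partial>P\<bar> \<le> exp B"
proof -
  have b: "exp (- B) \<le> exp (h x)" "exp (h x) \<le> exp B" if "x \<in> space W" for x
    using B[OF that] by auto
  have e: "(\<lambda>x. exp (h x)) \<in> borel_measurable W" by measurable
  show "integrable P (\<lambda>x. exp (h x))"
    by (rule prob_algebra_integrable_bounded[OF P e, of "exp B"]) (use b in auto)
  have lo: "exp (- B) \<le> (\<integral>x. exp (h x) \<partial>P)" and hi: "(\<integral>x. exp (h x) \<partial>P) \<le> exp B"
    using prob_algebra_integral_bounds[OF P e b] by auto
  show pos: "0 < (\<integral>x. exp (h x) \<partial>P)" by (rule less_le_trans[OF _ lo]) simp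
  show "\<bar>\<integral>x. exp (h x) \<partial>P\<bar> \<le> exp B" using pos hi by simp
  have "- B \<le> ln (\<integral>x. exp (h x) \<partial>P)" using lo pos by (simp add: ln_ge_iff)
  moreover have "ln (\<integral>x. exp (h x) \<partial>P) \<le> B" using hi pos by (metis exp_le_cancel_iff exp_ln)
  ultimately show "\<bar>ln (\<integral>x. exp (h x) \<partial>P)\<bar> \<le> B" by simp
qed

text \<open>Adding a constant to \<open>h\<close> changes both sides of the dual inequality by that
  constant. Subtracting \<open>ln I\<close> therefore reduces it to test functions with
  \<open>E_Q exp h = 1\<close>, for which the logarithm vanishes.\<close>

lemma dv_boundedI_normalized:
  assumes P: "P \<in> space (prob_algebra W)" and Q: "Q \<in> space (prob_algebra W)"
    and norm: "\<And>h B. h \<in> borel_measurable W \<Longrightarrow> (\<And>x. x \<in> space W \<Longrightarrow> \<bar>h x\<bar> \<le> B) \<Longrightarrow>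
        (\<integral>x. exp (h x) \<partial>Q) = 1 \<Longrightarrow> (\<integral>x. h x \<partial>P) \<le> c"
  shows "dv_bounded W P Q c"
  unfolding dv_bounded_def
proof (intro ballI allI impI)
  fix h :: "'a \<Rightarrow> real" and B
  assume h[measurable]: "h \<in> borel_measurable W" and B: "\<forall>x\<in>space W. \<bar>h x\<bar> \<le> B"
  interpret P: prob_space P using P by (simp add: space_prob_algebra)
  define I where "I = (\<integral>x. exp (h x) \<partial>Q)"
  have I: "0 < I" unfolding I_def by (rule prob_algebra_exp_integral_bounds[OF Q h]) (use B in auto)
  have "(\<integral>x. h x - ln I \<partial>P) \<le> c"
  proof (rule norm)
    show "(\<lambda>x. h x - ln I) \<in> borel_measurable W" by measurable
    show "\<bar>h x - ln I\<bar> \<le> B + \<bar>ln I\<bar>" if "x \<in> space W" for x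
      using B that by (intro order_trans[OF abs_triangle_ineq4] add_mono) auto
    show "(\<integral>x. exp (h x - ln I) \<partial>Q) = 1" using I by (simp add: exp_diff I_def)
  qed
  moreover have "integrable P h" using prob_algebra_integrable_bounded[OF P h] B by blast
  ultimately show "(\<integral>x. h x \<partial>P) \<le> ln (\<integral>x. exp (h x) \<partial>Q) + c"
    by (simp add: I_def P.prob_space)
qed

text \<open>Integrate \<open>h \<le> exp h - 1\<close>. The result is Jensen's inequality for
  \<open>exp\<close>, and is also used in that role.\<close>

lemma dv_bounded_refl:
  assumes P: "P \<in> space (prob_algebra W)"
  shows "dv_bounded W P P 0"
proof (rule dv_boundedI_normalized[OF P P])
  fix h :: "'a \<Rightarrow> real" and B
  assume h: "h \<in> borel_measurable W" "\<And>x. x \<in> space W \<Longrightarrow> \<bar>h x\<bar> \<le> B"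
    and one: "(\<integral>x. exp (h x) \<partial>P) = 1"
  interpret P: prob_space P using P by (simp add: space_prob_algebra)
  note i = prob_algebra_exp_integral_bounds(1)[OF P h]
  have "(\<integral>x. h x \<partial>P) \<le> (\<integral>x. exp (h x) - 1 \<partial>P)"
  proof (rule integral_mono)
    show "h x \<le> exp (h x) - 1" for x using exp_ge_add_one_self[of "h x"] by linarith
  qed (use i prob_algebra_integrable_bounded[OF P h] in auto)
  also have "\<dots> = 0" using one i by (simp add: P.prob_space)
  finally show "(\<integral>x. h x \<partial>P) \<le> 0" .
qed

lemma dv_bounded_nonneg:
  assumes "dv_bounded W P Q c" "P \<in> space (prob_algebra W)" "Q \<in> space (prob_algebra W)"
  shows "0 \<le> c"
proof -
  interpret Q: prob_space Q using assms by (simp add: space_prob_algebra)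
  show ?thesis using dv_boundedD[OF assms(1), of "\<lambda>_. 0" 0] by (simp add: Q.prob_space)
qed

text \<open>The Gibbs inequality, which is the easy half of Donsker--Varadhan duality. With
  \<open>D\<close> the density of \<open>P\<close>, the pointwise bound
  \<open>D * (h - ln D) \<le> exp h - D\<close> is integrated under \<open>Q\<close>, where the
  right side has mean \<open>1 - 1 = 0\<close>.\<close>

lemma KL_dv_bounded:
  assumes P: "P \<in> space (prob_algebra W)" and Q: "Q \<in> space (prob_algebra W)"
    and ac: "absolutely_continuous Q P" and int: "integrable P (entropy_density (exp 1) Q P)"
  shows "dv_bounded W P Q (KL_divergence (exp 1) Q P)"
proof (rule dv_boundedI_normalized[OF P Q])
  fix h :: "'a \<Rightarrow> real" and B
  assume h: "h \<in> borel_measurable W" "\<And>x. x \<in> space W \<Longrightarrow> \<bar>h x\<bar> \<le> B"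
    and one: "(\<integral>x. exp (h x) \<partial>Q) = 1"
  have ps: "prob_space P" "prob_space Q" and st: "sets P = sets Q" "sets Q = sets W"
    using P Q by (auto simp: space_prob_algebra)
  interpret Q: prob_space Q by fact
  note [measurable_cong] = st(2)
  have hQ[measurable]: "h \<in> borel_measurable Q" using h by measurable
  obtain D where D: "D \<in> borel_measurable Q" "\<And>x. 0 \<le> D x"
      "AE x in Q. RN_deriv Q P x = ennreal (D x)" "P = density Q (\<lambda>x. ennreal (D x))"
    using obtain_real_density[OF ps(2,1) ac st(1)] by blast
  note pD = probability_density_integral[OF ps(1)[unfolded D(4)] D(1,2)]
  let ?e = "entropy_density (exp 1) Q P"
  have e_meas: "?e \<in> borel_measurable Q" by measurable
  \<comment> \<open>The library defines the entropy density through \<open>RN_deriv\<close>, which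
    agrees with \<open>D\<close> only almost everywhere; hence the almost-everywhere comparison of
    integrals below.\<close>
  have e_eq: "AE x in Q. ?e x = ln (D x)"
    using D(3) by eventually_elim (simp add: entropy_density_def D(2) log_def)
  have KL: "KL_divergence (exp 1) Q P = (\<integral>x. D x * ?e x \<partial>Q)"
    unfolding KL_divergence_def
    using integral_density[of ?e Q D] D e_meas by simp
  have iDe: "integrable Q (\<lambda>x. D x * ?e x)"
    using int integrable_density[of ?e Q D] D e_meas by simp
  have iDh: "integrable Q (\<lambda>x. D x * h x)"
    using pD(1) hQ by (rule integrable_mult_bounded[where B = B])
      (use h(2) sets_eq_imp_space_eq[OF st(2)] in auto)
  note ie = prob_algebra_exp_integral_bounds(1)[OF Q h]
  have "(\<integral>x. h x \<partial>P) - KL_divergence (exp 1) Q P = (\<integral>x. D x * h x - D x * ?e x \<partial>Q)"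
    unfolding KL using integral_density[of h Q D] D hQ iDe iDh by simp
  also have "\<dots> \<le> (\<integral>x. exp (h x) - D x \<partial>Q)"
  proof (rule integral_mono_AE)
    show "AE x in Q. D x * h x - D x * ?e x \<le> exp (h x) - D x"
      using e_eq
    proof eventually_elim
      fix x assume e: "?e x = ln (D x)"
      show "D x * h x - D x * ?e x \<le> exp (h x) - D x"
      \<comment> \<open>Where the density vanishes the left side is 0 and the right side is
        \<open>exp (h x)\<close>. Elsewhere the claim is \<open>1 + y \<le> exp y\<close> at
        \<open>y = h x - ln (D x)\<close>, multiplied by \<open>D x\<close>.\<close>
      proof (cases "D x = 0")
        case False
        then have pos: "0 < D x" using D(2)[of x] by simp
        have "D x * (1 + (h x - ln (D x))) \<le> D x * exp (h x - ln (D x))"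
          using pos by (intro mult_left_mono exp_ge_add_one_self) auto
        also have "\<dots> = exp (h x)" using pos by (simp add: exp_diff)
        finally show ?thesis unfolding e by (simp add: algebra_simps)
      qed simp
    qed
  qed (use iDe iDh ie pD in auto)
  also have "\<dots> = 0" using ie pD one by simp
  finally show "(\<integral>x. h x \<partial>P) \<le> KL_divergence (exp 1) Q P" by simp
qed

section \<open>Integration against kernels, chain rule and Pinsker's inequality\<close>

lemma bind_in_prob_algebra:
  "P \<in> space (prob_algebra X) \<Longrightarrow> K \<in> X \<rightarrow>\<^sub>M prob_algebra W \<Longrightarrow> P \<bind> K \<in> space (prob_algebra W)"
  by (simp add: space_prob_algebra prob_space_bind'[of P X K W] sets_bind'[of P X K W])

lemma integral_bind_prob_algebra:
  fixes h :: "'a \<Rightarrow> real"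
  assumes P: "P \<in> space (prob_algebra X)" and K: "K \<in> X \<rightarrow>\<^sub>M prob_algebra W"
    and h: "h \<in> borel_measurable W" "\<And>x. x \<in> space W \<Longrightarrow> \<bar>h x\<bar> \<le> B"
  shows "(\<integral>w. h w \<partial>(P \<bind> K)) = (\<integral>x. \<integral>w. h w \<partial>K x \<partial>P)"
proof -
  interpret prob_space P using P by (simp add: space_prob_algebra)
  have st: "sets P = sets X" using P by (simp add: space_prob_algebra)
  have K': "K \<in> P \<rightarrow>\<^sub>M subprob_algebra W"
    using measurable_prob_algebraD[OF K] measurable_cong_sets[OF st refl] by blast
  have "K x \<in> space (prob_algebra W)" if "x \<in> space P" for x
    using K that sets_eq_imp_space_eq[OF st] by (auto dest: measurable_space)
  then have "prob_space (K x)" if "x \<in> space P" for x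
    using that by (auto simp: space_prob_algebra)
  then have "AE x in P. emeasure (K x) (space (K x)) \<le> ennreal 1"
    by (intro AE_I2) (simp add: prob_space.emeasure_space_1)
  from integral_bind[OF h K' finite_measure_axioms this] show ?thesis by simp
qed

lemma integral_kernel_measurable:
  fixes h :: "'a \<Rightarrow> real"
  assumes "K \<in> X \<rightarrow>\<^sub>M prob_algebra W" and "h \<in> borel_measurable W"
  shows "(\<lambda>x. \<integral>w. h w \<partial>K x) \<in> borel_measurable X"
  using measurable_compose[OF measurable_prob_algebraD[OF assms(1)]
      integral_measurable_subprob_algebra[OF assms(2)]] by simp

text \<open>The inner bound is applied to \<open>h\<close> at each \<open>x\<close>, and the outer
  bound to \<open>g x = ln (\<integral>w. exp (h w) \<partial>L x)\<close>. Since
  \<open>exp (g x)\<close> is the inner integral again, the two nested integrals under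
  \<open>Q\<close> and \<open>L\<close> merge into one under \<open>Q \<bind> L\<close>.\<close>

lemma dv_bounded_chain:
  assumes P: "P \<in> space (prob_algebra X)" and Q: "Q \<in> space (prob_algebra X)"
    and K: "K \<in> X \<rightarrow>\<^sub>M prob_algebra W" and L: "L \<in> X \<rightarrow>\<^sub>M prob_algebra W"
    and c: "dv_bounded X P Q c" and d: "\<And>x. x \<in> space X \<Longrightarrow> dv_bounded W (K x) (L x) d"
  shows "dv_bounded W (P \<bind> K) (Q \<bind> L) (c + d)"
  unfolding dv_bounded_def
proof (intro ballI allI impI)
  fix h :: "'b \<Rightarrow> real" and B
  assume h[measurable]: "h \<in> borel_measurable W" and "\<forall>x\<in>space W. \<bar>h x\<bar> \<le> B"
  then have B: "\<And>x. x \<in> space W \<Longrightarrow> \<bar>h x\<bar> \<le> B" by blast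
  interpret P: prob_space P using P by (simp add: space_prob_algebra)
  have sp: "space P = space X" "space Q = space X"
    using P Q by (simp_all add: space_prob_algebraD)
  have Kx: "K x \<in> space (prob_algebra W)" and Lx: "L x \<in> space (prob_algebra W)"
    if "x \<in> space X" for x
    using measurable_space[OF K that] measurable_space[OF L that] by auto
  define g where "g x = ln (\<integral>w. exp (h w) \<partial>L x)" for x
  have e: "(\<lambda>w. exp (h w)) \<in> borel_measurable W" by measurable
  have [measurable]: "(\<lambda>x. \<integral>w. exp (h w) \<partial>L x) \<in> borel_measurable X"
    by (rule integral_kernel_measurable[OF L e])
  have g: "g \<in> borel_measurable X" unfolding g_def by measurable
  have gB: "\<bar>g x\<bar> \<le> B" if "x \<in> space X" for x
    unfolding g_def using prob_algebra_exp_integral_bounds(3)[OF Lx[OF that] h B] .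
  have "(\<integral>w. h w \<partial>(P \<bind> K)) = (\<integral>x. \<integral>w. h w \<partial>K x \<partial>P)"
    by (rule integral_bind_prob_algebra[OF P K h B])
  also have "\<dots> \<le> (\<integral>x. g x + d \<partial>P)"
  proof (rule integral_mono)
    have "\<bar>\<integral>w. h w \<partial>K x\<bar> \<le> B" if "x \<in> space X" for x
      using prob_algebra_integral_bounds[OF Kx[OF that] h, of "- B" B] B by (fastforce simp: abs_le_iff)
    then show "integrable P (\<lambda>x. \<integral>w. h w \<partial>K x)"
      by (rule prob_algebra_integrable_bounded[OF P integral_kernel_measurable[OF K h]])
    show "integrable P (\<lambda>x. g x + d)" using prob_algebra_integrable_bounded[OF P g gB] by simp
    show "(\<integral>w. h w \<partial>K x) \<le> g x + d" if "x \<in> space P" for x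
      unfolding g_def using dv_boundedD[OF d h B] that sp by simp
  qed
  also have "\<dots> = (\<integral>x. g x \<partial>P) + d"
    using prob_algebra_integrable_bounded[OF P g gB] by (simp add: P.prob_space)
  also have "\<dots> \<le> ln (\<integral>x. exp (g x) \<partial>Q) + c + d"
    using dv_boundedD[OF c g gB] by simp
  also have "(\<integral>x. exp (g x) \<partial>Q) = (\<integral>x. \<integral>w. exp (h w) \<partial>L x \<partial>Q)"
  proof (rule Bochner_Integration.integral_cong)
    fix x assume "x \<in> space Q"
    then show "exp (g x) = (\<integral>w. exp (h w) \<partial>L x)"
      unfolding g_def using prob_algebra_exp_integral_bounds(2)[OF Lx h B] sp by simp
  qed simp
  also have "\<dots> = (\<integral>w. exp (h w) \<partial>(Q \<bind> L))"
    using integral_bind_prob_algebra[OF Q L e, of "exp B"] B by (fastforce simp: abs_le_iff)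
  finally show "(\<integral>w. h w \<partial>(P \<bind> K)) \<le> ln (\<integral>w. exp (h w) \<partial>(Q \<bind> L)) + (c + d)"
    by simp
qed

text \<open>Test functions on the image pull back along \<open>f\<close> with the same
  bound.\<close>

lemma dv_bounded_distr:
  assumes P: "P \<in> space (prob_algebra X)" and Q: "Q \<in> space (prob_algebra X)"
    and c: "dv_bounded X P Q c" and f[measurable]: "f \<in> X \<rightarrow>\<^sub>M W"
  shows "dv_bounded W (distr P W f) (distr Q W f) c"
  unfolding dv_bounded_def
proof (intro ballI allI impI)
  fix h :: "'b \<Rightarrow> real" and B
  assume h[measurable]: "h \<in> borel_measurable W" and B: "\<forall>x\<in>space W. \<bar>h x\<bar> \<le> B"
  have [measurable_cong]: "sets P = sets X" "sets Q = sets X"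
    using P Q by (auto simp: space_prob_algebra)
  have "(\<integral>x. h (f x) \<partial>P) \<le> ln (\<integral>x. exp (h (f x)) \<partial>Q) + c"
    using B measurable_space[OF f] by (intro dv_boundedD[OF c, where B = B]) auto
  then show "(\<integral>x. h x \<partial>distr P W f) \<le> ln (\<integral>x. exp (h x) \<partial>distr Q W f) + c"
    by (simp add: integral_distr)
qed

text \<open>For \<open>h = r * indicator A\<close> the logarithm is the cumulant generating function
  of a Bernoulli variable, at most \<open>r * measure Q A + r^2 / 8\<close> by Hoeffding's
  lemma.\<close>

lemma dv_bounded_pinsker:
  assumes P: "P \<in> space (prob_algebra W)" and Q: "Q \<in> space (prob_algebra W)"
    and c: "dv_bounded W P Q c" and A: "A \<in> sets W"
  shows "measure P A - measure Q A \<le> sqrt (c / 2)"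
proof (cases "measure P A \<le> measure Q A")
  case True
  \<comment> \<open>The real \<open>sqrt\<close> is negative at negative arguments, so
    \<open>0 \<le> c\<close> has to be known here.\<close>
  then show ?thesis using dv_bounded_nonneg[OF c P Q] by (smt (verit) real_sqrt_ge_0_iff divide_nonneg_pos)
next
  case False
  interpret P: prob_space P using P by (simp add: space_prob_algebra)
  interpret Q: prob_space Q using Q by (simp add: space_prob_algebra)
  have AP: "A \<in> sets P" "A \<in> sets Q" using A P Q by (auto simp: space_prob_algebra)
  define d where "d = measure P A - measure Q A"
  define r where "r = 4 * d" \<comment> \<open>the optimal parameter when \<open>d\<^sup>2 = c / 2\<close>\<close>
  have d: "0 < d" "0 < r" using False by (auto simp: d_def r_def)
  have "(\<integral>x. r * indicator A x \<partial>P) \<le> ln (\<integral>x. exp (r * indicator A x) \<partial>Q) + c"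
    using A by (intro dv_boundedD[OF c, where B = "\<bar>r\<bar>"]) (auto simp: indicator_def)
  moreover have "(\<integral>x. exp (r * indicator A x) \<partial>Q) = (\<integral>x. 1 + (exp r - 1) * indicator A x \<partial>Q)"
    by (intro Bochner_Integration.integral_cong) (auto simp: indicator_def)
  moreover have "\<dots> = 1 + measure Q A * (exp r - 1)"
  proof -
    have "integrable Q (indicator A :: _ \<Rightarrow> real)"
      using AP by (intro integrable_real_indicator) (auto simp: Q.emeasure_eq_measure)
    then show ?thesis using AP Q.prob_space by simp
  qed
  ultimately have "r * measure P A \<le> ln (1 + measure Q A * (exp r - 1)) + c"
    using AP by simp
  also have "ln (1 + measure Q A * (exp r - 1)) \<le> r * measure Q A + r\<^sup>2 / 8"
    using Hoeffdings_lemma_aux[of r "measure Q A"] d by simp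
  finally have "r * d \<le> r\<^sup>2 / 8 + c" by (simp add: d_def algebra_simps)
  \<comment> \<open>With \<open>r = 4 * d\<close> the previous line reads
    \<open>4 d^2 \<le> 2 d^2 + c\<close>.\<close>
  then have "d\<^sup>2 \<le> c / 2" by (simp add: r_def power2_eq_square)
  then show ?thesis unfolding d_def[symmetric] by (rule real_le_rsqrt)
qed

subsection \<open>Contraction by a kernel of small total variation diameter\<close>

text \<open>The two-point inequality says that every chord from \<open>(1, 1)\<close> to a point
  \<open>(b x, a x)\<close> on its right is at most as steep as every chord to such a point on its
  left. Hence one line through \<open>(1, 1)\<close> lies above all these points, and since
  \<open>b\<close> has mean 1 under \<open>Q\<close>, so that the slope drops out, the mean of
  \<open>a\<close> is at most 1.\<close>

lemma exp_integral_contraction: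
  assumes Q: "Q \<in> space (prob_algebra X)" and K: "K \<in> X \<rightarrow>\<^sub>M prob_algebra W"
    and tv: "\<And>x y A. x \<in> space X \<Longrightarrow> y \<in> space X \<Longrightarrow> A \<in> sets W \<Longrightarrow>
               measure (K x) A - measure (K y) A \<le> \<phi>"
    and \<phi>: "0 < \<phi>" "\<phi> \<le> 1"
    and h[measurable]: "h \<in> borel_measurable W" and B: "\<And>w. w \<in> space W \<Longrightarrow> \<bar>h w\<bar> \<le> B"
    and one: "(\<integral>x. \<integral>w. exp (h w) \<partial>K x \<partial>Q) = 1"
  shows "(\<integral>x. exp ((\<integral>w. h w \<partial>K x) / \<phi>) \<partial>Q) \<le> 1"
proof -
  interpret prob_space Q using Q by (simp add: space_prob_algebra)
  have sp: "space Q = space X" using Q by (rule space_prob_algebraD)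
  have Kx: "K x \<in> space (prob_algebra W)" if "x \<in> space X" for x
    using measurable_space[OF K that] .
  define b where "b x = (\<integral>w. exp (h w) \<partial>K x)" for x
  define F where "F x = (\<integral>w. h w \<partial>K x)" for x
  define a where "a x = exp (F x / \<phi>)" for x
  have [measurable]: "b \<in> borel_measurable X" unfolding b_def
    by (rule integral_kernel_measurable[OF K]) measurable
  have F_meas[measurable]: "F \<in> borel_measurable X"
    unfolding F_def by (rule integral_kernel_measurable[OF K h])
  have FB: "\<bar>F x\<bar> \<le> B" if "x \<in> space X" for x
    using prob_algebra_integral_bounds[OF Kx[OF that] h, of "- B" B] B
    unfolding F_def by (fastforce simp: abs_le_iff)
  have bB: "\<bar>b x\<bar> \<le> exp B" if "x \<in> space X" for x
    unfolding b_def using prob_algebra_exp_integral_bounds(4)[OF Kx[OF that] h B] .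
  have b_int: "integrable Q b"
    by (rule prob_algebra_integrable_bounded[OF Q _ bB]) measurable
  have a_int: "integrable Q a" unfolding a_def
  proof (rule prob_algebra_exp_integral_bounds(1)[OF Q])
    show "\<bar>F x / \<phi>\<bar> \<le> B / \<phi>" if "x \<in> space X" for x
      using FB[OF that] \<phi> by (simp add: abs_divide divide_right_mono)
  qed measurable
  have b_pos: "0 < b x" and jensen: "F x \<le> ln (b x)" if "x \<in> space X" for x
    unfolding b_def F_def using prob_algebra_exp_integral_bounds(2)[OF Kx[OF that] h B]
      dv_boundedD[OF dv_bounded_refl[OF Kx[OF that]] h B] by auto
  have a_le: "a x \<le> 1" if "x \<in> space X" "b x \<le> 1" for x
  proof -
    have "ln (b x) \<le> 0" using b_pos[OF that(1)] that(2) by simp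
    with jensen[OF that(1)] have "F x \<le> 0" by linarith
    then show ?thesis using \<phi> by (simp add: a_def divide_nonpos_pos)
  qed
  have b_one: "(\<integral>x. b x \<partial>Q) = 1" using one by (simp add: b_def)
  have line: "(\<integral>x. a x \<partial>Q) \<le> 1" if s: "AE x in Q. a x \<le> 1 + s * (b x - 1)" for s
  proof -
    have "(\<integral>x. a x \<partial>Q) \<le> (\<integral>x. 1 + s * (b x - 1) \<partial>Q)"
      using a_int b_int s by (intro integral_mono_AE) auto
    also have "\<dots> = 1" using b_int b_one by (simp add: prob_space)
    finally show ?thesis .
  qed
  have pair: "(a y - 1) / (b y - 1) \<le> (1 - a x) / (1 - b x)"
    if x: "x \<in> space X" "b x < 1" and y: "y \<in> space X" "1 < b y" for x y
  proof -
    \<comment> \<open>The weight for which \<open>b\<close> has mean exactly 1 under the two-point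
      law on \<open>x\<close> and \<open>y\<close>.\<close>
    define t where "t = (b y - 1) / (b y - b x)"
    have t: "0 \<le> t" "t \<le> 1" and t': "1 - t = (1 - b x) / (b y - b x)"
      using x y by (auto simp: t_def field_simps)
    have "t * b x + (1 - t) * b y = 1"
      unfolding t' unfolding t_def using x y by (simp add: divide_simps) (simp add: algebra_simps)
    then have "t * a x + (1 - t) * a y \<le> 1"
      unfolding a_def b_def F_def
      using two_point_exp[OF Kx[OF x(1)] Kx[OF y(1)] tv[OF x(1) y(1)] \<phi> h B t] by blast
    then have "(b y - 1) * a x + (1 - b x) * a y \<le> b y - b x"
      unfolding t' unfolding t_def using x y by (simp add: divide_simps split: if_splits)
    then show ?thesis using x y by (simp add: divide_simps) (simp add: algebra_simps)
  qed
  \<comment> \<open>If \<open>b\<close> stays on one side of 1, the horizontal line works: when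
    \<open>b \<ge> 1\<close>, mean 1 forces \<open>b = 1\<close> almost everywhere; when
    \<open>b \<le> 1\<close>, Jensen's inequality gives \<open>a \<le> 1\<close> at every
    point.\<close>
  consider "\<forall>x\<in>space X. 1 \<le> b x" | "\<forall>x\<in>space X. b x \<le> 1"
    | x0 y0 where "x0 \<in> space X" "b x0 < 1" "y0 \<in> space X" "1 < b y0"
    by (meson not_le)
  then have "(\<integral>x. a x \<partial>Q) \<le> 1"
  proof cases
    case 1
    have "(\<integral>x. b x - 1 \<partial>Q) = 0" using b_int b_one by (simp add: prob_space)
    then have "AE x in Q. b x - 1 = 0"
      using b_int 1 sp by (subst (asm) integral_nonneg_eq_0_iff_AE) auto
    then have "AE x in Q. a x \<le> 1 + 0 * (b x - 1)"
      using AE_space by eventually_elim (simp add: a_le sp)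
    then show ?thesis by (rule line)
  next
    case 2
    then have "AE x in Q. a x \<le> 1 + 0 * (b x - 1)" using a_le sp by (intro AE_I2) auto
    then show ?thesis by (rule line)
  next
    case 3
    \<comment> \<open>any slope between those of the chords to the right and to the left of \<open>1\<close> will do\<close>
    define Y where "Y = (\<lambda>y. (a y - 1) / (b y - 1)) ` {y\<in>space X. 1 < b y}"
    define s where "s = Sup Y"
    \<comment> \<open>The point \<open>y0\<close> makes \<open>Y\<close> nonempty, and the chord to
      \<open>x0\<close> bounds it above.\<close>
    have ne: "Y \<noteq> {}" and bdd: "bdd_above Y"
      unfolding Y_def using 3 pair[OF 3(1,2)] by (auto intro!: bdd_aboveI)
    have "a x \<le> 1 + s * (b x - 1)" if x: "x \<in> space X" for x
    proof (cases "b x" "1::real" rule: linorder_cases)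
      case less
      have "s \<le> (1 - a x) / (1 - b x)"
        unfolding s_def using ne by (rule cSup_least) (use pair[OF x less] in \<open>auto simp: Y_def\<close>)
      then show ?thesis using less by (simp add: divide_simps) (simp add: algebra_simps)
    next
      case equal
      then show ?thesis using a_le[OF x] by simp
    next
      case greater
      have "(a x - 1) / (b x - 1) \<le> s"
        unfolding s_def using bdd by (intro cSup_upper) (use x greater in \<open>auto simp: Y_def\<close>)
      then show ?thesis using greater by (simp add: pos_divide_le_eq)
    qed
    then show ?thesis using sp by (intro line[of s] AE_I2) auto
  qed
  then show ?thesis by (simp add: a_def F_def)
qed

text \<open>The strong data processing inequality. For normalized \<open>h\<close>, the hypothesis
  on \<open>P\<close> and \<open>Q\<close> is applied to \<open>u = E_K h / \<phi>\<close>; the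
  logarithm is at most 0 by \<open>exp_integral_contraction\<close>, so
  \<open>E_P u \<le> c\<close>, and multiplication by \<open>\<phi>\<close> finishes.\<close>

lemma dv_bounded_contraction:
  assumes P: "P \<in> space (prob_algebra X)" and Q: "Q \<in> space (prob_algebra X)"
    and K: "K \<in> X \<rightarrow>\<^sub>M prob_algebra W"
    and tv: "\<And>x y A. x \<in> space X \<Longrightarrow> y \<in> space X \<Longrightarrow> A \<in> sets W \<Longrightarrow>
               measure (K x) A - measure (K y) A \<le> \<phi>"
    and \<phi>: "0 < \<phi>" "\<phi> \<le> 1"
    and c: "dv_bounded X P Q c"
  shows "dv_bounded W (P \<bind> K) (Q \<bind> K) (\<phi> * c)"
proof (rule dv_boundedI_normalized[OF bind_in_prob_algebra[OF P K] bind_in_prob_algebra[OF Q K]])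
  fix h :: "'b \<Rightarrow> real" and B
  assume h[measurable]: "h \<in> borel_measurable W" and B: "\<And>w. w \<in> space W \<Longrightarrow> \<bar>h w\<bar> \<le> B"
    and one: "(\<integral>w. exp (h w) \<partial>(Q \<bind> K)) = 1"
  have e: "(\<lambda>w. exp (h w)) \<in> borel_measurable W" by measurable
  have "(\<integral>x. \<integral>w. exp (h w) \<partial>K x \<partial>Q) = 1"
    using integral_bind_prob_algebra[OF Q K e, of "exp B"] B one by (fastforce simp: abs_le_iff)
  note le = exp_integral_contraction[OF Q K tv \<phi> h B this]
  define u where "u x = (\<integral>w. h w \<partial>K x) / \<phi>" for x
  have u: "u \<in> borel_measurable X"
    unfolding u_def using integral_kernel_measurable[OF K h] by measurable
  have uB: "\<bar>u x\<bar> \<le> B / \<phi>" if "x \<in> space X" for x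
  proof -
    have "\<bar>\<integral>w. h w \<partial>K x\<bar> \<le> B"
      using prob_algebra_integral_bounds[OF measurable_space[OF K that] h, of "- B" B] B
      by (fastforce simp: abs_le_iff)
    then show ?thesis using \<phi> by (simp add: u_def abs_divide divide_right_mono)
  qed
  have "(\<integral>x. u x \<partial>P) \<le> ln (\<integral>x. exp (u x) \<partial>Q) + c" by (rule dv_boundedD[OF c u uB])
  moreover have "ln (\<integral>x. exp (u x) \<partial>Q) \<le> 0"
    using le prob_algebra_exp_integral_bounds(2)[OF Q u uB] unfolding u_def[symmetric]
    by (rule ln_le_zero_iff[THEN iffD2, rotated])
  ultimately have "(\<integral>x. u x \<partial>P) \<le> c" by linarith
  moreover have "(\<integral>x. u x \<partial>P) = (\<integral>x. \<integral>w. h w \<partial>K x \<partial>P) / \<phi>"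
    unfolding u_def by (rule integral_divide_zero)
  ultimately have "(\<integral>x. \<integral>w. h w \<partial>K x \<partial>P) \<le> \<phi> * c"
    using \<phi> by (simp add: pos_divide_le_eq mult.commute)
  then show "(\<integral>w. h w \<partial>(P \<bind> K)) \<le> \<phi> * c"
    using integral_bind_prob_algebra[OF P K h B] by simp
qed

lemma bind_eq_of_indistinguishable:
  assumes P: "P \<in> space (prob_algebra X)" and Q: "Q \<in> space (prob_algebra X)"
    and K: "K \<in> X \<rightarrow>\<^sub>M prob_algebra W"
    and tv: "\<And>x y A. x \<in> space X \<Longrightarrow> y \<in> space X \<Longrightarrow> A \<in> sets W \<Longrightarrow>
               measure (K x) A \<le> measure (K y) A"
  shows "P \<bind> K = Q \<bind> K"
proof -
  have Kx: "K x \<in> space (prob_algebra W)" if "x \<in> space X" for x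
    using measurable_space[OF K that] .
  have psP: "prob_space P" and psQ: "prob_space Q"
    using P Q by (auto simp: space_prob_algebra)
  then obtain x0 where x0: "x0 \<in> space X"
    using prob_space.not_empty[OF psP] space_prob_algebraD[OF P] by auto
  have eq: "K x = K x0" if x: "x \<in> space X" for x
  proof (rule measure_eqI)
    show "sets (K x) = sets (K x0)" using Kx[OF x] Kx[OF x0] by (simp add: space_prob_algebra)
    fix A assume "A \<in> sets (K x)"
    then have "A \<in> sets W" using Kx[OF x] by (simp add: space_prob_algebra)
    then have "measure (K x) A = measure (K x0) A" using tv x x0 by (intro antisym) auto
    moreover have "prob_space (K x)" "prob_space (K x0)"
      using Kx[OF x] Kx[OF x0] by (auto simp: space_prob_algebra)
    ultimately show "emeasure (K x) A = emeasure (K x0) A"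
      by (simp add: finite_measure.emeasure_eq_measure prob_space.finite_measure)
  qed
  have "R \<bind> K = K x0" if R: "R \<in> space (prob_algebra X)" for R
  proof -
    have "R \<bind> K = R \<bind> (\<lambda>_. K x0)"
      using eq space_prob_algebraD[OF R] by (intro bind_cong) auto
    also have "\<dots> = K x0"
      using R Kx[OF x0] by (intro bind_const') (auto simp: space_prob_algebra intro: prob_space_imp_subprob_space)
    finally show ?thesis .
  qed
  then show ?thesis using P Q by simp
qed

subsection \<open>Output laws of interactive mechanisms\<close>

text \<open>Privacy is applied to the complement of \<open>A\<close> with the two inputs exchanged.
  Writing \<open>a\<close> and \<open>b\<close> for the masses of \<open>A\<close> under
  \<open>K x1\<close> and \<open>K x2\<close>, this gives \<open>a \<le> 1 - (1 - \<delta>) * exp (-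
  \<epsilon>) + exp (- \<epsilon>) * b\<close>, and
  \<open>exp (- \<epsilon>) * b \<le> b\<close>.\<close>

lemma ldp_kernels_measure_diff_le:
  assumes "K \<in> ldp_kernels \<epsilon> \<delta> D W" and "0 \<le> \<epsilon>"
    and x: "x1 \<in> space D" "x2 \<in> space D" and A: "A \<in> sets W"
  shows "measure (K x1) A - measure (K x2) A \<le> 1 - (1 - \<delta>) * exp (- \<epsilon>)"
proof -
  have K: "K \<in> D \<rightarrow>\<^sub>M prob_algebra W" using assms(1) by (simp add: ldp_kernels_def)
  have ps: "prob_space (K x1)" "prob_space (K x2)" and st: "sets (K x1) = sets W" "sets (K x2) = sets W"
    using measurable_space[OF K x(1)] measurable_space[OF K x(2)] by (auto simp: space_prob_algebra)
  have sp: "space (K x1) = space W" "space (K x2) = space W"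
    using st by (auto dest: sets_eq_imp_space_eq)
  interpret K1: prob_space "K x1" by fact
  interpret K2: prob_space "K x2" by fact
  have "measure (K x2) (space W - A) - exp \<epsilon> * measure (K x1) (space W - A) \<le> \<delta>"
    using assms(1) x A unfolding ldp_kernels_def by blast
  then have "(1 - measure (K x2) A) - exp \<epsilon> * (1 - measure (K x1) A) \<le> \<delta>"
    using K1.prob_compl[of A] K2.prob_compl[of A] A st sp by simp
  then have "exp (- \<epsilon>) * ((1 - measure (K x2) A) - exp \<epsilon> * (1 - measure (K x1) A)) \<le> exp (- \<epsilon>) * \<delta>"
    by (intro mult_left_mono) auto
  moreover have "exp (- \<epsilon>) * ((1 - measure (K x2) A) - exp \<epsilon> * (1 - measure (K x1) A))
      = exp (- \<epsilon>) * (1 - measure (K x2) A) - (1 - measure (K x1) A)"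
    by (simp add: right_diff_distrib exp_minus)
  ultimately have "measure (K x1) A \<le> 1 - exp (- \<epsilon>) * (1 - measure (K x2) A) + exp (- \<epsilon>) * \<delta>"
    by linarith
  moreover have "exp (- \<epsilon>) * measure (K x2) A \<le> 1 * measure (K x2) A"
    using assms(2) by (intro mult_right_mono) auto
  ultimately show ?thesis by (simp add: algebra_simps)
qed

lemma transcript_law_cong:
  assumes "\<And>j. j < i \<Longrightarrow> x j = y j"
  shows "transcript_law Z K x i = transcript_law Z K y i"
  using assms by (induction i) simp_all

text \<open>Taking a measure instead of a kernel lets the same operation serve for a fixed sample
  and for the average over the sample.\<close>

definition append_output ::
  "(nat \<Rightarrow> 'z measure) \<Rightarrow> nat \<Rightarrow> 'z measure \<Rightarrow> (nat \<Rightarrow> 'z) \<Rightarrow> (nat \<Rightarrow> 'z) measure" where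
  "append_output Z i M z = distr M (PiM {..<Suc i} Z) (\<lambda>w. z(i := w))"

lemma measurable_fun_upd_output:
  "(\<lambda>(z, w). z(i := w)) \<in> PiM {..<i} Z \<Otimes>\<^sub>M Z i \<rightarrow>\<^sub>M PiM {..<Suc i} Z"
  unfolding split_beta'
  by (rule measurable_fun_upd[where J = "{..<i}"]) (auto simp: lessThan_Suc)

lemma measurable_append_output:
  assumes M: "M \<in> L \<rightarrow>\<^sub>M prob_algebra (Z i)" and z: "z \<in> L \<rightarrow>\<^sub>M PiM {..<i} Z"
  shows "(\<lambda>y. append_output Z i (M y) (z y)) \<in> L \<rightarrow>\<^sub>M prob_algebra (PiM {..<Suc i} Z)"
  unfolding append_output_def using M
proof (rule measurable_distr_prob_space2)
  show "(\<lambda>(y, w). (z y)(i := w)) \<in> L \<Otimes>\<^sub>M Z i \<rightarrow>\<^sub>M PiM {..<Suc i} Z"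
    unfolding split_beta' using z
    by (intro measurable_fun_upd[where J = "{..<i}"] measurable_compose[OF measurable_fst z])
      (auto simp: lessThan_Suc)
qed

section \<open>Recursion for the output law\<close>

locale interactive_mechanism =
  fixes n :: nat and X :: "'x measure" and Z :: "nat \<Rightarrow> 'z measure"
    and K :: "nat \<Rightarrow> 'x \<times> (nat \<Rightarrow> 'z) \<Rightarrow> 'z measure"
  assumes K_measurable: "i < n \<Longrightarrow> K i \<in> X \<Otimes>\<^sub>M PiM {..<i} Z \<rightarrow>\<^sub>M prob_algebra (Z i)"
begin

lemma measurable_kernel_compose:
  assumes "i < n" "f \<in> L \<rightarrow>\<^sub>M X" "g \<in> L \<rightarrow>\<^sub>M PiM {..<i} Z"
  shows "(\<lambda>y. K i (f y, g y)) \<in> L \<rightarrow>\<^sub>M prob_algebra (Z i)"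
  using measurable_compose[OF measurable_Pair[OF assms(2,3)] K_measurable[OF assms(1)]] .

lemma append_measurable:
  assumes "i < n" "f \<in> L \<rightarrow>\<^sub>M X" "g \<in> L \<rightarrow>\<^sub>M PiM {..<i} Z"
  shows "(\<lambda>y. append_output Z i (K i (f y, g y)) (g y)) \<in> L \<rightarrow>\<^sub>M prob_algebra (PiM {..<Suc i} Z)"
  by (rule measurable_append_output[OF measurable_kernel_compose[OF assms] assms(3)])

lemma transcript_law_Suc:
  "transcript_law Z K x (Suc i) = transcript_law Z K x i \<bind> (\<lambda>z. append_output Z i (K i (x i, z)) z)"
  by (simp add: append_output_def)

text \<open>The index set \<open>I\<close> may exceed \<open>{..<i}\<close>, because the induction
  step must view the law of the first \<open>i\<close> outputs as a function of a longer sample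
  vector.\<close>

lemma transcript_law_measurable:
  assumes "i \<le> n" "{..<i} \<subseteq> I"
  shows "(\<lambda>x. transcript_law Z K x i) \<in> PiM I (\<lambda>_. X) \<rightarrow>\<^sub>M prob_algebra (PiM {..<i} Z)"
  using assms
proof (induction i)
  case 0
  have "return (PiM {} Z) (\<lambda>_. undefined) \<in> space (prob_algebra (PiM {} Z))"
    by (rule measurable_space[OF measurable_return_prob_space]) (simp add: space_PiM)
  then show ?case by simp
next
  case (Suc i)
  then have "i < n" "i \<in> I" "{..<i} \<subseteq> I" by auto
  show ?case unfolding transcript_law_Suc
  proof (rule measurable_bind_prob_space2)
    show "(\<lambda>x. transcript_law Z K x i) \<in> PiM I (\<lambda>_. X) \<rightarrow>\<^sub>M prob_algebra (PiM {..<i} Z)"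
      using Suc \<open>{..<i} \<subseteq> I\<close> by simp
    show "(\<lambda>(x, z). append_output Z i (K i (x i, z)) z)
        \<in> PiM I (\<lambda>_. X) \<Otimes>\<^sub>M PiM {..<i} Z \<rightarrow>\<^sub>M prob_algebra (PiM {..<Suc i} Z)"
      unfolding split_beta' using \<open>i < n\<close> \<open>i \<in> I\<close>
      by (intro append_measurable measurable_snd
          measurable_compose[OF measurable_fst measurable_component_singleton]) auto
  qed
qed

lemma PiM_in_prob_algebra:
  assumes P: "P \<in> space (prob_algebra X)"
  shows "PiM I (\<lambda>_. P) \<in> space (prob_algebra (PiM I (\<lambda>_. X)))"
  using P by (auto simp: space_prob_algebra intro!: prob_space_PiM sets_PiM_cong)

lemma output_law_in_prob_algebra:
  assumes "P \<in> space (prob_algebra X)" "i \<le> n"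
  shows "output_law i Z K P \<in> space (prob_algebra (PiM {..<i} Z))"
  unfolding output_law_def
  by (rule bind_in_prob_algebra[OF PiM_in_prob_algebra[OF assms(1)]
        transcript_law_measurable[OF assms(2) subset_refl]])

lemma output_law_0:
  "output_law 0 Z K P = output_law 0 Z K Q"
  by (simp add: output_law_def PiM_empty)

lemma marginal_kernel_measurable:
  assumes P: "P \<in> space (prob_algebra X)" and i: "i < n"
  shows "(\<lambda>z. P \<bind> (\<lambda>a. K i (a, z))) \<in> PiM {..<i} Z \<rightarrow>\<^sub>M prob_algebra (Z i)"
proof (rule measurable_bind_prob_space2)
  show "(\<lambda>z. P) \<in> PiM {..<i} Z \<rightarrow>\<^sub>M prob_algebra X" using P by simp
  show "(\<lambda>(z, a). K i (a, z)) \<in> PiM {..<i} Z \<Otimes>\<^sub>M X \<rightarrow>\<^sub>M prob_algebra (Z i)"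
    unfolding split_beta' by (rule measurable_kernel_compose[OF i measurable_snd measurable_fst])
qed

lemma append_marginal_measurable:
  assumes P: "P \<in> space (prob_algebra X)" and i: "i < n"
  shows "(\<lambda>z. append_output Z i (P \<bind> (\<lambda>a. K i (a, z))) z)
    \<in> PiM {..<i} Z \<rightarrow>\<^sub>M prob_algebra (PiM {..<Suc i} Z)"
  using marginal_kernel_measurable[OF P i] by (rule measurable_append_output) measurable

text \<open>The history is a function of the first \<open>i\<close> samples and private randomness,
  hence independent of sample \<open>i\<close>. By Fubini, this sample can be averaged out inside
  the kernel at a fixed history.\<close>

lemma output_law_Suc:
  assumes P: "P \<in> space (prob_algebra X)" and i: "i < n"
  shows "output_law (Suc i) Z K P =
    output_law i Z K P \<bind> (\<lambda>z. append_output Z i (P \<bind> (\<lambda>a. K i (a, z))) z)"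
proof -
  let ?R = "PiM {..<i} (\<lambda>_. P)" and ?T = "\<lambda>r. transcript_law Z K r i"
    and ?W = "PiM {..<Suc i} Z" and ?H = "PiM {..<i} Z" and ?XX = "PiM {..<i} (\<lambda>_. X)"
  let ?g = "\<lambda>a z. append_output Z i (K i (a, z)) z"
  have R: "?R \<in> space (prob_algebra ?XX)" by (rule PiM_in_prob_algebra[OF P])
  have psP: "prob_space P" and psR: "prob_space ?R"
    and [measurable_cong]: "sets P = sets X" "sets ?R = sets ?XX"
    using P R by (auto simp: space_prob_algebra)
  have spP: "space P = space X" and spR: "space ?R = space ?XX"
    using P R by (simp_all add: space_prob_algebraD)
  interpret P: prob_space P by fact
  interpret R: prob_space ?R by fact
  interpret PR: pair_prob_space P ?R ..
  have T: "?T \<in> ?XX \<rightarrow>\<^sub>M prob_algebra ?H"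
    using i by (intro transcript_law_measurable) auto
  have T': "?T \<in> ?R \<rightarrow>\<^sub>M subprob_algebra ?H"
    using measurable_prob_algebraD[OF T] by measurable
  have TS: "(\<lambda>x. transcript_law Z K x (Suc i)) \<in> PiM {..<Suc i} (\<lambda>_. X) \<rightarrow>\<^sub>M prob_algebra ?W"
    using i by (intro transcript_law_measurable) auto
  have C: "(\<lambda>(a, r). ?T r \<bind> ?g a) \<in> P \<Otimes>\<^sub>M ?R \<rightarrow>\<^sub>M subprob_algebra ?W"
    unfolding split_beta'
  proof (intro measurable_prob_algebraD measurable_bind_prob_space2[where N = ?H])
    show "(\<lambda>x. ?T (snd x)) \<in> P \<Otimes>\<^sub>M ?R \<rightarrow>\<^sub>M prob_algebra ?H"
      using T by measurable
    show "(\<lambda>(x, z). ?g (fst x) z) \<in> (P \<Otimes>\<^sub>M ?R) \<Otimes>\<^sub>M ?H \<rightarrow>\<^sub>M prob_algebra ?W"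
      unfolding split_beta' by (rule append_measurable[OF i]) measurable
  qed
  have PiM_Suc: "PiM {..<Suc i} (\<lambda>_. P)
      = distr (P \<Otimes>\<^sub>M ?R) (PiM {..<Suc i} (\<lambda>_. P)) (\<lambda>(a, r). r(i := a))"
    using distr_pair_PiM_eq_PiM[of "{..<i}" "\<lambda>_. P" i] psP by (simp add: lessThan_Suc)
  have upd: "(\<lambda>(a, r). r(i := a)) \<in> P \<Otimes>\<^sub>M ?R \<rightarrow>\<^sub>M PiM {..<Suc i} (\<lambda>_. P)"
    unfolding split_beta'
    by (rule measurable_fun_upd[where J = "{..<i}"]) (auto simp: lessThan_Suc)
  have TS': "(\<lambda>x. transcript_law Z K x (Suc i)) \<in> PiM {..<Suc i} (\<lambda>_. P) \<rightarrow>\<^sub>M subprob_algebra ?W"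
    using measurable_prob_algebraD[OF TS] \<open>sets P = sets X\<close>
    by (subst measurable_cong_sets[OF sets_PiM_cong[OF refl] refl]) auto
  have "output_law (Suc i) Z K P
      = P \<Otimes>\<^sub>M ?R \<bind> (\<lambda>p. transcript_law Z K (case p of (a, r) \<Rightarrow> r(i := a)) (Suc i))"
    unfolding output_law_def
    by (subst PiM_Suc, rule bind_distr[OF upd TS' PR.not_empty])
  \<comment> \<open>The first \<open>i\<close> outputs do not read coordinate \<open>i\<close>, so
    the update drops out of their law.\<close>
  also have "\<dots> = P \<Otimes>\<^sub>M ?R \<bind> (\<lambda>(a, r). ?T r \<bind> ?g a)"
    unfolding transcript_law_Suc
    by (intro bind_cong) (auto intro!: bind_cong transcript_law_cong)
  also have "\<dots> = P \<bind> (\<lambda>a. ?R \<bind> (\<lambda>r. return (P \<Otimes>\<^sub>M ?R) (a, r))) \<bind> (\<lambda>(a, r). ?T r \<bind> ?g a)"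
    by (subst PR.pair_measure_eq_bind) simp
  also have "\<dots> = P \<bind> (\<lambda>a. ?R \<bind> (\<lambda>r. ?T r \<bind> ?g a))"
  proof -
    have "(\<lambda>a. ?R \<bind> (\<lambda>r. return (P \<Otimes>\<^sub>M ?R) (a, r))) \<in> P \<rightarrow>\<^sub>M subprob_algebra (P \<Otimes>\<^sub>M ?R)"
      by (rule measurable_bind[where N = "?R"]) (auto simp: space_subprob_algebra prob_space_imp_subprob_space psR)
    from bind_assoc[OF this C] show ?thesis
      by (simp, intro bind_cong refl, subst bind_assoc[where N = "P \<Otimes>\<^sub>M ?R", OF _ C])
        (auto intro!: bind_cong simp: bind_return[OF C] space_pair_measure)
  qed
  \<comment> \<open>The integral over the new sample moves inwards in two exchanges: past the
    earlier samples here, and past the history next.\<close>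
  also have "\<dots> = ?R \<bind> (\<lambda>r. P \<bind> (\<lambda>a. ?T r \<bind> ?g a))"
    by (rule PR.bind_rotate[OF C])
  also have "\<dots> = ?R \<bind> (\<lambda>r. ?T r \<bind> (\<lambda>z. P \<bind> (\<lambda>a. ?g a z)))"
  proof (intro bind_cong refl)
    fix r assume "r \<in> space ?R"
    then have Tr: "?T r \<in> space (prob_algebra ?H)" using measurable_space[OF T] spR by auto
    then have [measurable_cong]: "sets (?T r) = sets ?H" by (simp add: space_prob_algebra)
    interpret Tr: prob_space "?T r" using Tr by (simp add: space_prob_algebra)
    interpret PT: pair_prob_space P "?T r" ..
    show "P \<bind> (\<lambda>a. ?T r \<bind> ?g a) = ?T r \<bind> (\<lambda>z. P \<bind> (\<lambda>a. ?g a z))"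
      by (rule PT.bind_rotate[where N = ?W], unfold split_beta',
          rule measurable_prob_algebraD, rule append_measurable[OF i]) measurable
  qed
  \<comment> \<open>At a fixed history, appending is a pushforward, which commutes with mixing over
    the sample.\<close>
  also have "\<dots> = ?R \<bind> (\<lambda>r. ?T r \<bind> (\<lambda>z. append_output Z i (P \<bind> (\<lambda>a. K i (a, z))) z))"
  proof (intro bind_cong refl)
    fix r z assume "r \<in> space ?R" "z \<in> space (?T r)"
    then have z: "z \<in> space ?H"
      using measurable_space[OF T] spR by (auto dest: space_prob_algebraD)
    have "(\<lambda>a. K i (a, z)) \<in> P \<rightarrow>\<^sub>M prob_algebra (Z i)"
      using z by (intro measurable_kernel_compose[OF i]) measurable
    moreover have "(\<lambda>w. z(i := w)) \<in> Z i \<rightarrow>\<^sub>M ?W"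
      using measurable_compose[OF measurable_Pair1'[OF z] measurable_fun_upd_output] by simp
    ultimately show "P \<bind> (\<lambda>a. ?g a z) = append_output Z i (P \<bind> (\<lambda>a. K i (a, z))) z"
      unfolding append_output_def
      by (intro distr_bind[symmetric] P.not_empty measurable_prob_algebraD)
  qed
  also have "\<dots> = (?R \<bind> ?T) \<bind> (\<lambda>z. append_output Z i (P \<bind> (\<lambda>a. K i (a, z))) z)"
    by (rule bind_assoc[symmetric, OF T' measurable_prob_algebraD])
      (rule append_marginal_measurable[OF P i])
  finally show ?thesis unfolding output_law_def .
qed

end

subsection \<open>The minimax bound\<close>

text \<open>Given the history \<open>z\<close>, the next output is a private kernel fed with a fresh
  sample, so its divergence bound is \<open>\<phi> * c\<close> uniformly in \<open>z\<close>. The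
  chain rule adds this amount once per step.\<close>

lemma dv_bounded_output_law:
  assumes mech: "K \<in> interactive_mechanisms \<epsilon> \<delta> n X Z" and \<epsilon>: "0 \<le> \<epsilon>" and \<delta>: "\<delta> \<le> 1"
    and \<phi>: "\<phi> = 1 - (1 - \<delta>) * exp (- \<epsilon>)" "0 \<le> \<phi>"
    and P: "P \<in> space (prob_algebra X)" and Q: "Q \<in> space (prob_algebra X)"
    and c: "0 < \<phi> \<Longrightarrow> dv_bounded X P Q c" and i: "i \<le> n"
  shows "dv_bounded (PiM {..<i} Z) (output_law i Z K P) (output_law i Z K Q) (real i * (\<phi> * c))"
proof -
  interpret interactive_mechanism n X Z K
    using mech by unfold_locales (auto simp: interactive_mechanisms_def)
  have single: "dv_bounded (Z j) (P \<bind> (\<lambda>a. K j (a, z))) (Q \<bind> (\<lambda>a. K j (a, z))) (\<phi> * c)"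
    if j: "j < n" and z: "z \<in> space (PiM {..<j} Z)" for j z
  proof -
    have ldp: "(\<lambda>a. K j (a, z)) \<in> ldp_kernels \<epsilon> \<delta> X (Z j)"
      using mech j z by (auto simp: interactive_mechanisms_def)
    then have Kz: "(\<lambda>a. K j (a, z)) \<in> X \<rightarrow>\<^sub>M prob_algebra (Z j)" by (simp add: ldp_kernels_def)
    have tv: "measure (K j (x, z)) A - measure (K j (y, z)) A \<le> \<phi>"
      if "x \<in> space X" "y \<in> space X" "A \<in> sets (Z j)" for x y A
      using ldp_kernels_measure_diff_le[OF ldp \<epsilon> that] by (simp add: \<phi>)
    show ?thesis
    proof (cases "\<phi> = 0")
      case True
      have "P \<bind> (\<lambda>a. K j (a, z)) = Q \<bind> (\<lambda>a. K j (a, z))"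
        using tv True by (intro bind_eq_of_indistinguishable[OF P Q Kz]) auto
      then show ?thesis
        using dv_bounded_refl[OF bind_in_prob_algebra[OF Q Kz]] True by simp
    next
      case False
      then show ?thesis
        using \<phi> \<delta> by (intro dv_bounded_contraction[OF P Q Kz tv _ _ c]) auto
    qed
  qed
  show ?thesis using i
  proof (induction i)
    case 0
    then show ?case
      using dv_bounded_refl[OF output_law_in_prob_algebra[OF Q, of 0]] output_law_0[of P Q] by simp
  next
    case (Suc i)
    then have i: "i < n" "i \<le> n" by auto
    have "dv_bounded (PiM {..<Suc i} Z) (append_output Z i (P \<bind> (\<lambda>a. K i (a, z))) z)
        (append_output Z i (Q \<bind> (\<lambda>a. K i (a, z))) z) (\<phi> * c)"
      if z: "z \<in> space (PiM {..<i} Z)" for z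
      unfolding append_output_def
    proof (rule dv_bounded_distr[OF _ _ single[OF i(1) z]])
      show "(\<lambda>w. z(i := w)) \<in> Z i \<rightarrow>\<^sub>M PiM {..<Suc i} Z"
        using measurable_compose[OF measurable_Pair1'[OF z] measurable_fun_upd_output] by simp
    qed (use measurable_space[OF marginal_kernel_measurable[OF _ i(1)] z] P Q in auto)
    from dv_bounded_chain[OF output_law_in_prob_algebra[OF P i(2)]
        output_law_in_prob_algebra[OF Q i(2)] 
        append_marginal_measurable[OF P i(1)] append_marginal_measurable[OF Q i(1)] Suc.IH[OF i(2)] this]
    show ?case
      unfolding output_law_Suc[OF P i(1)] output_law_Suc[OF Q i(1)] by (simp add: algebra_simps)
  qed
qed

text \<open>On the event \<open>B\<close> that \<open>f0\<close> is below \<open>\<tau>\<close>,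
  separation makes \<open>f1\<close> exceed \<open>\<tau>\<close>; off \<open>B\<close>,
  \<open>f0\<close> is at least \<open>\<tau>\<close>. Markov's inequality turns both integrals into
  error probabilities of the test \<open>B\<close>, whose sum is at least \<open>1 - s\<close>, and
  the maximum is at least half of the sum.\<close>

lemma le_cam_two_point:
  assumes M0: "M0 \<in> space (prob_algebra W)" and M1: "M1 \<in> space (prob_algebra W)"
    and f0[measurable]: "f0 \<in> borel_measurable W" and f1[measurable]: "f1 \<in> borel_measurable W"
    and sep: "\<And>z. z \<in> space W \<Longrightarrow> 2 * \<tau> \<le> f0 z + f1 z" and \<tau>: "0 < \<tau>"
    and dist: "\<And>A. A \<in> sets W \<Longrightarrow> measure M0 A - measure M1 A \<le> s"
  shows "ennreal (\<tau> / 2 * (1 - s)) \<le> max (\<integral>\<^sup>+z. ennreal (f0 z) \<partial>M0) (\<integral>\<^sup>+z. ennreal (f1 z) \<partial>M1)"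
proof -
  interpret M0: prob_space M0 using M0 by (simp add: space_prob_algebra)
  interpret M1: prob_space M1 using M1 by (simp add: space_prob_algebra)
  have st: "sets M0 = sets W" "sets M1 = sets W" using M0 M1 by (auto simp: space_prob_algebra)
  have sp: "space M0 = space W" "space M1 = space W" using M0 M1 by (simp_all add: space_prob_algebraD)
  define B where "B = {z\<in>space W. f0 z < \<tau>}"
  have B: "B \<in> sets W" unfolding B_def by measurable
  then have B': "space W - B \<in> sets W" by auto
  have "ennreal (\<tau> * measure M0 (space W - B)) = (\<integral>\<^sup>+z. ennreal \<tau> * indicator (space W - B) z \<partial>M0)"
    using B' st \<tau> by (simp add: nn_integral_cmult_indicator M0.emeasure_eq_measure ennreal_mult)
  also have "\<dots> \<le> (\<integral>\<^sup>+z. ennreal (f0 z) \<partial>M0)"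
    using sp by (intro nn_integral_mono) (auto simp: B_def indicator_def intro!: ennreal_leI)
  finally have 0: "ennreal (\<tau> * measure M0 (space W - B)) \<le> (\<integral>\<^sup>+z. ennreal (f0 z) \<partial>M0)" .
  have "ennreal (\<tau> * measure M1 B) = (\<integral>\<^sup>+z. ennreal \<tau> * indicator B z \<partial>M1)"
    using B st \<tau> by (simp add: nn_integral_cmult_indicator M1.emeasure_eq_measure ennreal_mult)
  also have "\<dots> \<le> (\<integral>\<^sup>+z. ennreal (f1 z) \<partial>M1)"
    using sp sep by (intro nn_integral_mono) (fastforce simp: B_def indicator_def intro!: ennreal_leI)
  finally have 1: "ennreal (\<tau> * measure M1 B) \<le> (\<integral>\<^sup>+z. ennreal (f1 z) \<partial>M1)" .
  have "measure M0 (space W - B) = 1 - measure M0 B"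
    using M0.prob_compl[of B] B st sp by simp
  then have "1 - s \<le> measure M0 (space W - B) + measure M1 B" using dist[OF B] by simp
  then have "\<tau> * (1 - s) \<le> \<tau> * (measure M0 (space W - B) + measure M1 B)"
    using \<tau> by (intro mult_left_mono) auto
  then have "\<tau> / 2 * (1 - s) \<le> max (\<tau> * measure M0 (space W - B)) (\<tau> * measure M1 B)"
    by (simp add: algebra_simps max_def split: if_splits)
  then have "ennreal (\<tau> / 2 * (1 - s))
      \<le> max (ennreal (\<tau> * measure M0 (space W - B))) (ennreal (\<tau> * measure M1 B))"
    unfolding le_max_iff_disj by (blast intro: ennreal_leI)
  also have "\<dots> \<le> max (\<integral>\<^sup>+z. ennreal (f0 z) \<partial>M0) (\<integral>\<^sup>+z. ennreal (f1 z) \<partial>M1)"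
    by (rule max.mono[OF 0 1])
  finally show ?thesis .
qed

text \<open>For \<open>\<phi> = 0\<close> the outputs carry no information, even if the divergence is infinite; hence the
  guard on the last hypothesis.\<close>

lemma minimax_risk_ge:
  fixes X :: "'x measure" and T :: "'t measure"
  assumes "0 \<le> \<epsilon>" "0 \<le> \<delta>" "\<delta> \<le> 1"
    and \<P>: "\<P> \<subseteq> space (prob_algebra X)" and \<theta>: "\<And>P. P \<in> \<P> \<Longrightarrow> \<theta> P \<in> space T"
    and l: "semimetric_on (space T) l"
    and l_meas: "\<And>P. P \<in> \<P> \<Longrightarrow> (\<lambda>a. l a (\<theta> P)) \<in> borel_measurable T"
    and P01: "P0 \<in> \<P>" "P1 \<in> \<P>" and \<tau>: "0 < \<tau>" "2 * \<tau> \<le> l (\<theta> P0) (\<theta> P1)"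
    and \<phi>: "\<phi> = 1 - (1 - \<delta>) * exp (- \<epsilon>)"
    and c: "0 < \<phi> \<Longrightarrow> dv_bounded X P0 P1 c"
  shows "ennreal (\<tau> / 2 * (1 - sqrt (\<phi> * real n / 2 * c)))
    \<le> minimax_risk TYPE('z) n X T \<P> \<theta> l \<epsilon> \<delta>"
  unfolding minimax_risk_def
proof (intro INF_greatest)
  fix Z :: "nat \<Rightarrow> 'z measure" and K \<Psi>
  assume mech: "K \<in> interactive_mechanisms \<epsilon> \<delta> n X Z" and \<Psi>[measurable]: "\<Psi> \<in> PiM {..<n} Z \<rightarrow>\<^sub>M T"
  interpret interactive_mechanism n X Z K
    using mech by unfold_locales (auto simp: interactive_mechanisms_def)
  have P: "P0 \<in> space (prob_algebra X)" "P1 \<in> space (prob_algebra X)" using \<P> P01 by auto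
  have "(1 - \<delta>) * exp (- \<epsilon>) \<le> 1" using assms(1-3) by (intro mult_le_one) auto
  then have \<phi>0: "0 \<le> \<phi>" by (simp add: \<phi>)
  note out = output_law_in_prob_algebra[OF P(1) order_refl] output_law_in_prob_algebra[OF P(2) order_refl]
  note dv = dv_bounded_output_law[OF mech assms(1,3) \<phi> \<phi>0 P c order_refl]
  have "ennreal (\<tau> / 2 * (1 - sqrt (\<phi> * real n / 2 * c)))
      \<le> max (\<integral>\<^sup>+z. ennreal (l (\<Psi> z) (\<theta> P0)) \<partial>output_law n Z K P0)
            (\<integral>\<^sup>+z. ennreal (l (\<Psi> z) (\<theta> P1)) \<partial>output_law n Z K P1)"
  proof (rule le_cam_two_point[OF out])
    show "(\<lambda>z. l (\<Psi> z) (\<theta> P0)) \<in> borel_measurable (PiM {..<n} Z)"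
      "(\<lambda>z. l (\<Psi> z) (\<theta> P1)) \<in> borel_measurable (PiM {..<n} Z)"
      using P01 by (auto intro: measurable_compose[OF \<Psi> l_meas])
    fix z assume "z \<in> space (PiM {..<n} Z)"
    then have "\<Psi> z \<in> space T" by (rule measurable_space[OF \<Psi>])
    \<comment> \<open>The triangle inequality through \<open>\<Psi> z\<close>, with symmetry to move
      the estimate into the first argument.\<close>
    then have "l (\<theta> P0) (\<theta> P1) \<le> l (\<Psi> z) (\<theta> P0) + l (\<Psi> z) (\<theta> P1)"
      using l \<theta>[OF P01(1)] \<theta>[OF P01(2)] unfolding semimetric_on_def by metis
    with \<tau> show "2 * \<tau> \<le> l (\<Psi> z) (\<theta> P0) + l (\<Psi> z) (\<theta> P1)" by simp
  next
    fix A assume "A \<in> sets (PiM {..<n} Z)"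
    from dv_bounded_pinsker[OF out dv this]
    show "measure (output_law n Z K P0) A - measure (output_law n Z K P1) A
        \<le> sqrt (\<phi> * real n / 2 * c)"
      by (simp add: ac_simps)
  qed (use \<tau> in auto)
  also have "\<dots> \<le> (SUP P\<in>\<P>. \<integral>\<^sup>+z. ennreal (l (\<Psi> z) (\<theta> P)) \<partial>output_law n Z K P)"
    using P01 by (auto intro: SUP_upper)
  finally show "ennreal (\<tau> / 2 * (1 - sqrt (\<phi> * real n / 2 * c)))
    \<le> (SUP P\<in>\<P>. \<integral>\<^sup>+z. ennreal (l (\<Psi> z) (\<theta> P)) \<partial>output_law n Z K P)" .
qed

theorem lemma4:
  fixes X :: "'x measure" and T :: "'t measure"
    and \<P> :: "'x measure set" and \<theta> :: "'x measure \<Rightarrow> 't" and l :: "'t \<Rightarrow> 't \<Rightarrow> real"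
    and P0 P1 :: "'x measure" and \<epsilon> \<delta> \<tau> :: real and n :: nat
  assumes "0 \<le> \<epsilon>" and "0 \<le> \<delta>" and "\<delta> \<le> 1" and "1 \<le> n"
    and "\<P> \<subseteq> space (prob_algebra X)"
    and "\<And>P. P \<in> \<P> \<Longrightarrow> \<theta> P \<in> space T"
    and "semimetric_on (space T) l"
    and "\<And>P. P \<in> \<P> \<Longrightarrow> (\<lambda>a. l a (\<theta> P)) \<in> borel_measurable T"
    and "P0 \<in> \<P>" and "P1 \<in> \<P>"
    and "0 < \<tau>" and "2 * \<tau> \<le> l (\<theta> P0) (\<theta> P1)"
  shows "ereal (\<tau> / 2) *
           (1 - esqrt (ereal ((1 - (1 - \<delta>) * exp (- \<epsilon>)) * real n / 2) * KL_div P0 P1))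
         \<le> enn2ereal (minimax_risk TYPE('z) n X T \<P> \<theta> l \<epsilon> \<delta>)"
proof -
  define \<phi> where "\<phi> = 1 - (1 - \<delta>) * exp (- \<epsilon>)"
  have ge: "ennreal (\<tau> / 2 * (1 - sqrt (\<phi> * real n / 2 * c)))
      \<le> minimax_risk TYPE('z) n X T \<P> \<theta> l \<epsilon> \<delta>" if "0 < \<phi> \<Longrightarrow> dv_bounded X P0 P1 c" for c
    using minimax_risk_ge[OF assms(1-3,5-12) \<phi>_def that] .
  have finite_case: "ereal (\<tau> / 2) * (1 - ereal s)
      \<le> enn2ereal (minimax_risk TYPE('z) n X T \<P> \<theta> l \<epsilon> \<delta>)"
    if "ennreal (\<tau> / 2 * (1 - s)) \<le> minimax_risk TYPE('z) n X T \<P> \<theta> l \<epsilon> \<delta>" for s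
  proof -
    have "ereal (\<tau> / 2) * (1 - ereal s) = ereal (\<tau> / 2 * (1 - s))"
      by (simp add: one_ereal_def)
    \<comment> \<open>Only an inequality: \<open>ennreal\<close> sends a negative bound to
      0.\<close>
    also have "\<dots> \<le> enn2ereal (ennreal (\<tau> / 2 * (1 - s)))"
    proof (cases "0 \<le> \<tau> / 2 * (1 - s)")
      case True
      then show ?thesis by (simp only: enn2ereal_ennreal order_refl)
    next
      case False
      then have "ereal (\<tau> / 2 * (1 - s)) \<le> 0" by simp
      then show ?thesis using enn2ereal_nonneg by (rule order_trans)
    qed
    also have "\<dots> \<le> enn2ereal (minimax_risk TYPE('z) n X T \<P> \<theta> l \<epsilon> \<delta>)"
      using that by (simp add: less_eq_ennreal.rep_eq)
    finally show ?thesis .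
  qed
  have "(1 - \<delta>) * exp (- \<epsilon>) \<le> 1" using assms(1-3) by (intro mult_le_one) auto
  then have "0 \<le> \<phi>" by (simp add: \<phi>_def)
  then consider "\<phi> = 0" | "0 < \<phi>" "KL_div P0 P1 = \<infinity>"
    | "KL_div P0 P1 = ereal (KL_divergence (exp 1) P1 P0)" "absolutely_continuous P1 P0"
      "integrable P0 (entropy_density (exp 1) P1 P0)"
    unfolding KL_div_def
    by (cases "\<phi> = 0";
        cases "absolutely_continuous P1 P0 \<and> integrable P0 (entropy_density (exp 1) P1 P0)") auto
  then show ?thesis unfolding \<phi>_def[symmetric]
  proof cases
    \<comment> \<open>In \<open>ereal\<close> the product of 0 and infinity is 0, so the bound to
      prove is \<open>\<tau> / 2\<close> even for infinite divergence; the guard in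
      \<open>ge\<close> holds vacuously.\<close>
    case 1
    then show "ereal (\<tau> / 2) * (1 - esqrt (ereal (\<phi> * real n / 2) * KL_div P0 P1))
        \<le> enn2ereal (minimax_risk TYPE('z) n X T \<P> \<theta> l \<epsilon> \<delta>)"
      using finite_case[of 0] ge[of 0] by (simp add: esqrt_def zero_ereal_def)
  next
    \<comment> \<open>As \<open>n \<ge> 1\<close>, the root is infinite, and as
      \<open>\<tau> > 0\<close>, the left side is minus infinity.\<close>
    case 2
    then show "ereal (\<tau> / 2) * (1 - esqrt (ereal (\<phi> * real n / 2) * KL_div P0 P1))
        \<le> enn2ereal (minimax_risk TYPE('z) n X T \<P> \<theta> l \<epsilon> \<delta>)"
      using assms(4,11) by (simp add: esqrt_def one_ereal_def)
  next
    case 3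
    have "dv_bounded X P0 P1 (KL_divergence (exp 1) P1 P0)"
      using assms(5,9,10) 3 by (intro KL_dv_bounded) auto
    then have "0 < \<phi> \<Longrightarrow> dv_bounded X P0 P1 (KL_divergence (exp 1) P1 P0)" .
    from finite_case[OF ge[OF this]]
    show "ereal (\<tau> / 2) * (1 - esqrt (ereal (\<phi> * real n / 2) * KL_div P0 P1))
        \<le> enn2ereal (minimax_risk TYPE('z) n X T \<P> \<theta> l \<epsilon> \<delta>)"
      by (simp add: 3 esqrt_def)
  qed
qed

end
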